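(* Let $\gamma_1,\gamma_2,\varkappa,\varrho,\Upsilon\in\mathbb{C}$ have positive real parts. For $\left|\frac{\nu_2^\Upsilon}{q^\Upsilon}\right|<1$ and $\left|\frac{\nu_1^\Upsilon q^\Upsilon}{p(q^\Upsilon-\nu_2^\Upsilon)}\right|<1$ (with transform variables $p,q$, $\mathrm{Re}(p),\mathrm{Re}(q)>0$), the double Laplace transform of the modified bivariate H–K Mittag-Leffler function with $\gamma_3=\frac{\gamma_1+1}{2}$ and $\gamma_4=\gamma_2$ satisfies $$\mathbb{L}_2\left[X^{\varkappa-1}Y^{\varrho-1}E_{\varkappa,\varrho,\Upsilon}^{(\gamma_1;\gamma_2;\frac{\gamma_1+1}{2};\gamma_2)}(\nu_1X,\nu_2Y)\right](p,q)=\frac{1}{q^\varrho p^\varkappa}\left[\frac{q^\Upsilon-\nu_2^\Upsilon}{q^\Upsilon}\right]^{-\gamma_2}\left[1-\frac{4\nu_1q^\Upsilon}{p(q^\Upsilon-\nu_2^\Upsilon)}\right]^{-\frac{\gamma_1}{2}}.$$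
   Context: $(a)_k$ is the Pochhammer symbol. The modified bivariate H–K Mittag-Leffler function is $$E_{\varkappa,\varrho,\Upsilon}^{(\gamma_1;\gamma_2;\gamma_3;\gamma_4)}(X,Y)=\sum_{s=0}^\infty\sum_{r=0}^\infty\frac{(\gamma_1)_{2s}(\gamma_2)_{s+r}X^sY^{\Upsilon r}}{(\gamma_3)_s(\gamma_4)_s\Gamma(\varkappa+s)\Gamma(\varrho+\Upsilon r)\,r!\,s!},$$ for complex parameters with positive real parts. The double Laplace transform is $\mathbb{L}_2[h](p,q)=\int_0^\infty\int_0^\infty e^{-(pX+qY)}h(X,Y)\,dX\,dY$, $\mathrm{Re}(p),\mathrm{Re}(q)>0$. Here $\nu_1,\nu_2$ are constants.
   Formalization: The stated conditions do not make the double Laplace integral converge (e.g. ν₂=0, Υ=ν₁=1, p=2, ϰ=γ₁/2), so the identity is asserted where it converges absolutely at (p,q); absolute convergence for all sufficiently large Re p, Re q is also proved. *)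

theory Defs
  imports "HOL-Analysis.Analysis"
begin

text \<open>
  The power \<open>Y^(\<Upsilon> r)\<close> is written \<open>(Y powr \<Upsilon>) ^ r\<close>. For \<open>Y \<noteq> 0\<close> this is the principal
  value \<open>Y powr (\<Upsilon> * of_nat r)\<close>; at \<open>Y = 0\<close> it gives the intended value 1 for \<open>r = 0\<close>,
  whereas \<open>0 powr 0 = 0\<close>.
\<close>

definition HK_mittag_leffler ::
  "complex \<Rightarrow> complex \<Rightarrow> complex \<Rightarrow> complex \<Rightarrow> complex \<Rightarrow> complex \<Rightarrow> complex \<Rightarrow>
   complex \<Rightarrow> complex \<Rightarrow> complex"
where
  "HK_mittag_leffler \<gamma>1 \<gamma>2 \<gamma>3 \<gamma>4 \<kappa> \<rho> \<Upsilon> X Y =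
     (\<Sum>s. \<Sum>r. pochhammer \<gamma>1 (2 * s) * pochhammer \<gamma>2 (s + r) * X ^ s * (Y powr \<Upsilon>) ^ r /
       (pochhammer \<gamma>3 s * pochhammer \<gamma>4 s * Gamma (\<kappa> + of_nat s) *
        Gamma (\<rho> + \<Upsilon> * of_nat r) * fact r * fact s))"

definition double_laplace ::
  "(real \<Rightarrow> real \<Rightarrow> complex) \<Rightarrow> complex \<Rightarrow> complex \<Rightarrow> complex"
where
  "double_laplace h p q =
     (LINT Y:{0<..}|lborel. (LINT X:{0<..}|lborel.
        exp (- (p * of_real X + q * of_real Y)) * h X Y))"

text \<open>
  Since the Lebesgue integral of a non-integrable function is 0 by convention, existence of
  the double Laplace transform at \<open>(p, q)\<close> is a separate predicate: absolute convergence of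
  the double integral, so that the order of integration is immaterial.
\<close>

definition double_laplace_exists ::
  "(real \<Rightarrow> real \<Rightarrow> complex) \<Rightarrow> complex \<Rightarrow> complex \<Rightarrow> bool"
where
  "double_laplace_exists h p q \<longleftrightarrow>
     set_integrable lborel ({0<..} \<times> {0<..})
       (\<lambda>(X, Y). exp (- (p * of_real X + q * of_real Y)) * h X Y)"

end

theory Submission
  imports Defs "HOL-Complex_Analysis.Complex_Analysis"
begin

text \<open>
  Since \<open>(\<gamma>\<^sub>1)\<^sub>2\<^sub>s = 4\<^sup>s (\<gamma>\<^sub>1/2)\<^sub>s ((\<gamma>\<^sub>1+1)/2)\<^sub>s\<close> and \<open>(\<gamma>\<^sub>2)\<^sub>s\<^sub>+\<^sub>r = (\<gamma>\<^sub>2)\<^sub>s (\<gamma>\<^sub>2+s)\<^sub>r\<close>, the termwise Laplace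
  transform of the double series is a binomial series in \<open>r\<close> inside a binomial series in \<open>s\<close>.
  Termwise integration is legitimate for large \<open>Re p\<close>, \<open>Re q\<close>: for complex \<open>\<Upsilon>\<close> the ratio
  \<open>\<Gamma>(Re z) / |\<Gamma>(z)|\<close> grows at most exponentially in \<open>|Im z|\<close> (Euler's limit for \<open>\<Gamma>\<close> and the sine
  product), so the double series of absolute integrals is dominated by a geometric one.

  At a given point \<open>(p, q)\<close> of absolute convergence the series need not converge, and the formula is
  reached by analytic continuation along rays. First \<open>q\<close> is approached along \<open>t q\<close>, \<open>t \<rightarrow> 1\<close>, with
  the first variable fixed at a large multiple of \<open>p\<close>; there \<open>|\<nu>\<^sub>2\<^sup>\<Upsilon> / (t q)\<^sup>\<Upsilon>| < 1\<close> keeps all powers on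
  the principal branch. Then \<open>p\<close> is approached along \<open>t p\<close>, \<open>t \<rightarrow> 1\<close>. The last factor is
  \<open>(1 - c/t) powr (-\<gamma>\<^sub>1/2)\<close> with \<open>c = 4 \<nu>\<^sub>1 / (p (1 - \<nu>\<^sub>2\<^sup>\<Upsilon> / q\<^sup>\<Upsilon>))\<close>, and the ray meets the branch cut only if
  \<open>c\<close> is real and \<open>c \<ge> 1\<close>; in that case the formula blows up as \<open>t \<rightarrow> c\<close>, contradicting the
  boundedness of the transform on \<open>Re p' \<ge> Re p\<close>.
\<close>

subsection \<open>Laplace integrals and continuation along rays\<close>

text \<open>By Tonelli the integral of the sum of the norms is finite, hence that sum is finite
  almost everywhere. This supplies the pointwise hypothesis of the library rules for termwise
  integration.\<close>

lemma AE_summable_norm_of_summable_integral: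
  fixes f :: "nat \<Rightarrow> 'a \<Rightarrow> 'b::{banach, second_countable_topology}"
  assumes [measurable]: "\<And>i. integrable M (f i)"
    and sum: "summable (\<lambda>i. \<integral>x. norm (f i x) \<partial>M)"
  shows "AE x in M. summable (\<lambda>i. norm (f i x))"
proof -
  have "(\<integral>\<^sup>+x. (\<Sum>i. ennreal (norm (f i x))) \<partial>M) = (\<Sum>i. \<integral>\<^sup>+x. ennreal (norm (f i x)) \<partial>M)"
    by (rule nn_integral_suminf) simp
  also have "\<dots> = (\<Sum>i. ennreal (\<integral>x. norm (f i x) \<partial>M))"
    by (intro suminf_cong nn_integral_eq_integral) (auto intro: assms)
  also have "\<dots> \<noteq> \<infinity>"
    using sum by (auto simp: ennreal_suminf_neq_top)
  finally have "AE x in M. (\<Sum>i. ennreal (norm (f i x))) \<noteq> \<infinity>"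
    by (intro nn_integral_PInf_AE) simp_all
  then show ?thesis
    by eventually_elim (auto intro: summable_suminf_not_top)
qed

lemma norm_exp_mult_le:
  fixes z :: complex
  assumes "0 \<le> Re z" "0 \<le> u"
  shows "norm (exp (- (z * of_real u)) * c) \<le> norm c"
proof -
  have "exp (- (Re z * u)) \<le> 1" using assms by simp
  then show ?thesis by (simp add: norm_mult mult_left_le_one_le)
qed

lemma integrable_laplace:
  fixes g :: "'a \<Rightarrow> complex"
  assumes g: "integrable M g" and [measurable]: "u \<in> borel_measurable M"
    and u: "AE x in M. 0 \<le> (u x :: real)" and z: "0 \<le> Re z"
  shows "integrable M (\<lambda>x. exp (- (z * of_real (u x))) * g x)"
proof (rule Bochner_Integration.integrable_bound[OF g])
  show "AE x in M. norm (exp (- (z * of_real (u x))) * g x) \<le> norm (g x)"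
    using u by eventually_elim (rule norm_exp_mult_le[OF z])
qed (use g in measurable)

text \<open>Expand \<open>exp (- ((w - z0) * u))\<close> in powers of \<open>w - z0\<close> and
  integrate termwise. On the ball of radius \<open>Re z0\<close>, the growth
  \<open>exp (norm (w - z0) * u)\<close> of the series of norms is absorbed by
  \<open>exp (- (Re z0 * u))\<close>, so \<open>norm (g x)\<close> dominates all partial sums.
  Measure and weight \<open>u\<close> stay general, so that either coordinate of the quadrant can
  serve as \<open>u\<close>.\<close>

lemma laplace_analytic:
  fixes g :: "'a \<Rightarrow> complex"
  assumes g: "integrable M g" and um[measurable]: "u \<in> borel_measurable M"
    and u: "AE x in M. 0 \<le> (u x :: real)"
  shows "(\<lambda>z. \<integral>x. exp (- (z * of_real (u x))) * g x \<partial>M) analytic_on {z. Re z > 0}"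
proof -
  have [measurable]: "g \<in> borel_measurable M" using g by simp
  have "(\<lambda>z. \<integral>x. exp (- (z * of_real (u x))) * g x \<partial>M) holomorphic_on ball z0 (Re z0)"
    if z0: "Re z0 > 0" for z0
  proof (rule power_series_holomorphic)
    fix w assume w: "w \<in> ball z0 (Re z0)"
    define c where "c = norm (w - z0)"
    have c: "0 \<le> c" "c < Re z0" using w by (auto simp: c_def dist_norm norm_minus_commute)
    define f where "f n x = (- ((w - z0) * of_real (u x))) ^ n / fact n * (exp (- (z0 * of_real (u x))) * g x)" for n x
    have nf: "norm (f n x) = (c * u x) ^ n / fact n * (exp (- (Re z0 * u x)) * norm (g x))" if "0 \<le> u x" for n x
      using that by (simp add: f_def c_def norm_mult norm_divide norm_power power_mult_distrib)
    have esum: "(\<lambda>n. (c * u x) ^ n / fact n) sums exp (c * u x)" for x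
      using exp_converges[of "c * u x"] by (simp add: divide_inverse mult.commute)
    \<comment> \<open>One bound, uniform in \<open>N\<close>, serves twice: for integrability of
      each term and for summability of the integrals of the norms.\<close>
    have bound: "(\<Sum>n<N. norm (f n x)) \<le> norm (g x)" if "0 \<le> u x" for N x
    proof -
      have "(\<Sum>n<N. (c * u x) ^ n / fact n) \<le> exp (c * u x)"
        using sum_le_suminf[OF sums_summable[OF esum], of "{..<N}" x] that c
        by (simp add: sums_unique[OF esum, symmetric])
      also have "\<dots> \<le> exp (Re z0 * u x)" using c that by (simp add: mult_right_mono)
      finally have "(\<Sum>n<N. (c * u x) ^ n / fact n) * (exp (- (Re z0 * u x)) * norm (g x))
        \<le> exp (Re z0 * u x) * (exp (- (Re z0 * u x)) * norm (g x))"
        by (rule mult_right_mono) simp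
      also have "\<dots> = norm (g x)" by (simp add: exp_minus)
      finally show ?thesis using that by (simp add: nf sum_distrib_right)
    qed
    have bound1: "norm (f n x) \<le> norm (g x)" if "0 \<le> u x" for n x
      using bound[OF that, of "Suc n"] sum_nonneg[of "{..<n}" "\<lambda>n. norm (f n x)"] by simp
    have [measurable]: "f n \<in> borel_measurable M" for n unfolding f_def by measurable
    have fint: "integrable M (f n)" for n
    proof (rule Bochner_Integration.integrable_bound[OF g])
      show "AE x in M. norm (f n x) \<le> norm (g x)" using u by eventually_elim (rule bound1)
    qed simp
    have fsum: "summable (\<lambda>n. \<integral>x. norm (f n x) \<partial>M)"
    proof (rule summableI_nonneg_bounded)
      fix N
      have "(\<Sum>n<N. \<integral>x. norm (f n x) \<partial>M) = (\<integral>x. (\<Sum>n<N. norm (f n x)) \<partial>M)"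
        using fint by (subst Bochner_Integration.integral_sum) auto
      also have "\<dots> \<le> (\<integral>x. norm (g x) \<partial>M)"
        using u fint g by (intro integral_mono_AE) (auto intro: bound)
      finally show "(\<Sum>n<N. \<integral>x. norm (f n x) \<partial>M) \<le> (\<integral>x. norm (g x) \<partial>M)" .
    qed simp
    have "(\<lambda>n. integral\<^sup>L M (f n)) sums (\<integral>x. (\<Sum>n. f n x) \<partial>M)"
      by (intro sums_integral fint fsum AE_summable_norm_of_summable_integral)
    moreover have "(\<Sum>n. f n x) = exp (- (w * of_real (u x))) * g x" for x
    proof -
      have "(\<lambda>n. f n x) sums (exp (- ((w - z0) * of_real (u x))) * (exp (- (z0 * of_real (u x))) * g x))"
        unfolding f_def using exp_converges[of "- ((w - z0) * of_real (u x))"]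
        by (intro sums_mult2) (simp add: scaleR_conv_of_real divide_inverse mult.commute)
      then show ?thesis by (simp add: sums_iff exp_add[symmetric] mult.assoc[symmetric] algebra_simps)
    qed
    moreover have "integral\<^sup>L M (f n) =
        (\<integral>x. (- of_real (u x)) ^ n / fact n * (exp (- (z0 * of_real (u x))) * g x) \<partial>M) * (w - z0) ^ n" for n
    proof -
      have "f n = (\<lambda>x. (- of_real (u x)) ^ n / fact n * (exp (- (z0 * of_real (u x))) * g x) * (w - z0) ^ n)"
        unfolding f_def by (subst minus_mult_right, subst power_mult_distrib) (simp add: mult_ac)
      then show ?thesis by (simp only: integral_mult_left_zero)
    qed
    ultimately show "(\<lambda>n. (\<integral>x. (- of_real (u x)) ^ n / fact n * (exp (- (z0 * of_real (u x))) * g x) \<partial>M) * (w - z0) ^ n)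
      sums (\<integral>x. exp (- (w * of_real (u x))) * g x \<partial>M)" by simp
  qed
  then show ?thesis unfolding analytic_on_def by blast
qed

text \<open>Dominated convergence with majorant \<open>norm (g x)\<close>. The boundary
  \<open>Re z = 0\<close> is included; this is where limits replace analyticity.\<close>

lemma laplace_tendsto:
  fixes g :: "'a \<Rightarrow> complex"
  assumes g: "integrable M g" and um[measurable]: "u \<in> borel_measurable M"
    and u: "AE x in M. 0 \<le> (u x :: real)"
    and z: "\<And>n. 0 \<le> Re (z n)" and lim: "z \<longlonglongrightarrow> a"
  shows "(\<lambda>n::nat. \<integral>x. exp (- (z n * of_real (u x))) * g x \<partial>M) \<longlonglongrightarrow> (\<integral>x. exp (- (a * of_real (u x))) * g x \<partial>M)"
proof (rule integral_dominated_convergence[where w = "\<lambda>x. norm (g x)"])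
  have [measurable]: "g \<in> borel_measurable M" using g by simp
  show "(\<lambda>x. exp (- (a * of_real (u x))) * g x) \<in> borel_measurable M"
     "(\<lambda>x. exp (- (z n * of_real (u x))) * g x) \<in> borel_measurable M" for n by measurable
  show "AE x in M. (\<lambda>n. exp (- (z n * of_real (u x))) * g x) \<longlonglongrightarrow> exp (- (a * of_real (u x))) * g x"
    by (intro AE_I2 tendsto_intros lim)
  show "AE x in M. norm (exp (- (z n * of_real (u x))) * g x) \<le> norm (g x)" for n
    using u by eventually_elim (rule norm_exp_mult_le[OF z])
qed (use g in simp)

lemma of_real_islimpt_greaterThan: "complex_of_real (e + 1) islimpt of_real ` {e<..}"
  unfolding islimpt_approachable
proof safe
  fix d :: real assume "d > 0"
  then show "\<exists>x'\<in>complex_of_real ` {e<..}. x' \<noteq> of_real (e + 1) \<and> dist x' (of_real (e + 1)) < d"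
    by (intro bexI[of _ "of_real (e + 1 + d / 2)"])
       (auto simp: dist_norm norm_divide simp flip: of_real_diff of_real_add)
qed

text \<open>Analyticity on the ray means holomorphy on some open neighbourhood. The identity theorem
  applies there because the far part of the ray, where agreement is known, has a limit
  point.\<close>

lemma analytic_continuation_ray:
  fixes f G :: "complex \<Rightarrow> complex" and t0 T t :: real
  assumes "f analytic_on (of_real ` {t0<..})" "G analytic_on (of_real ` {t0<..})"
    and eq: "\<And>t. t > T \<Longrightarrow> f (of_real t) = G (of_real t)" and t: "t > t0"
  shows "f (of_real t) = G (of_real t)"
proof -
  let ?R = "complex_of_real ` {t0<..}"
  have "(\<lambda>z. f z - G z) analytic_on ?R" using assms by (intro analytic_on_diff)
  then obtain U where U: "open U" "?R \<subseteq> U" "(\<lambda>z. f z - G z) holomorphic_on U"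
    unfolding analytic_on_holomorphic by blast
  define T1 where "T1 = max t0 T"
  \<comment> \<open>\<open>U\<close> may be disconnected; its component through \<open>t\<close>
    contains the whole connected ray.\<close>
  define V where "V = connected_component_set U (of_real t)"
  have "connected ?R" by (intro connected_continuous_image continuous_intros) auto
  then have RV: "?R \<subseteq> V" unfolding V_def
    by (rule connected_component_maximal[rotated]) (use U t in auto)
  have V: "V \<subseteq> U" "open V" "connected V"
    unfolding V_def using U by (auto simp: connected_component_subset open_connected_component)
  have holo: "(\<lambda>z. f z - G z) holomorphic_on V" using U V holomorphic_on_subset by blast
  have inV: "complex_of_real (T1 + 1) \<in> V"
    by (rule subsetD[OF RV imageI]) (simp add: T1_def)
  have "f (of_real t) - G (of_real t) = 0"
    by (rule analytic_continuation[OF holo V(2,3) _ inV of_real_islimpt_greaterThan])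
       (use RV eq t in \<open>auto simp: T1_def\<close>)
  then show ?thesis by simp
qed

subsection \<open>Powers and the Gamma function\<close>

text \<open>The power jumps across the cut, so continuity cannot be invoked. For real
  \<open>t < 0\<close> the principal logarithm is \<open>ln \<bar>t\<bar> + \<i> * pi\<close>, which
  gives an explicit measurable formula.\<close>

lemma borel_measurable_of_real_powr [measurable (raw)]:
  assumes f: "f \<in> borel_measurable M"
  shows "(\<lambda>x. complex_of_real (f x) powr w) \<in> borel_measurable M"
proof -
  have "(\<lambda>t. if t = 0 then 0 else exp (w * (of_real (ln \<bar>t\<bar>) + (if t < 0 then \<i> * of_real pi else 0)))) \<in> borel_measurable borel"
    by measurable
  moreover have "(\<lambda>t. complex_of_real t powr w) = (\<lambda>t. if t = 0 then 0 else exp (w * (of_real (ln \<bar>t\<bar>) + (if t < 0 then \<i> * of_real pi else 0))))"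
  proof (intro ext)
    fix t :: real
    show "complex_of_real t powr w = (if t = 0 then 0 else exp (w * (of_real (ln \<bar>t\<bar>) + (if t < 0 then \<i> * of_real pi else 0))))"
      using Ln_minus[of "complex_of_real (- t)"] Ln_of_real[of t] Ln_of_real[of "- t"]
      by (cases t "0::real" rule: linorder_cases) (auto simp: powr_def)
  qed
  ultimately have "(\<lambda>t. complex_of_real t powr w) \<in> borel_measurable borel" by simp
  with f show ?thesis by (rule measurable_compose)
qed

section \<open>Laplace transforms of complex powers\<close>

lemma set_integrable_exp_powr:
  fixes z p :: complex
  assumes z: "Re z > 0" and p: "Re p > 0"
  shows "set_integrable lborel {0<..} (\<lambda>t. exp (- (p * of_real t)) * of_real t powr (z - 1))"
proof -
  have "set_integrable lebesgue {0<..} (\<lambda>t. complex_of_real t powr (z - 1) / of_real (exp (Re p * t)))"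
    using absolutely_integrable_Gamma_integral[OF z p] .
  then have "integrable lborel (\<lambda>t. indicat_real {0<..} t *\<^sub>R (complex_of_real t powr (z - 1) / of_real (exp (Re p * t))))"
    unfolding set_integrable_def by (subst (asm) integrable_completion) auto
  then show ?thesis
    unfolding set_integrable_def
    by (rule Bochner_Integration.integrable_bound)
       (auto simp: indicator_def norm_mult norm_divide exp_minus divide_inverse norm_inverse)
qed

text \<open>Substitution of \<open>a * t\<close> for \<open>t\<close> in Euler's integral for
  \<open>Gamma z\<close>.\<close>

lemma laplace_powr_real:
  fixes z :: complex and a :: real
  assumes z: "Re z > 0" and a: "a > 0"
  shows "(LINT t:{0<..}|lborel. exp (- (of_real a * of_real t)) * of_real t powr (z - 1)) = Gamma z / of_real a powr z"
proof -
  let ?g = "\<lambda>t. indicat_real {0<..} t *\<^sub>R (exp (- complex_of_real t) * complex_of_real t powr (z - 1))"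
  have int: "set_integrable lborel {0<..} (\<lambda>t. exp (- complex_of_real t) * complex_of_real t powr (z - 1))"
    using set_integrable_exp_powr[OF z, of 1] by simp
  have "(LINT t:{0<..}|lborel. exp (- complex_of_real t) * complex_of_real t powr (z - 1))
    = integral {0<..} (\<lambda>t. exp (- complex_of_real t) * complex_of_real t powr (z - 1))"
    by (rule set_borel_integral_eq_integral(2)[OF int])
  also have "\<dots> = Gamma z"
    using Gamma_integral_complex'[OF z]
    by (intro integral_unique) (simp add: exp_minus divide_inverse mult.commute exp_of_real)
  finally have "integral\<^sup>L lborel ?g = Gamma z" by (simp add: set_lebesgue_integral_def)
  then have "Gamma z = a *\<^sub>R (LBINT t. ?g (0 + a * t))"
    using a by (subst (asm) lborel_integral_real_affine[of a _ 0]) auto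
  also have "(LBINT t. ?g (0 + a * t)) =
      (LBINT t. of_real a powr (z - 1) * (indicat_real {0<..} t *\<^sub>R (exp (- (of_real a * of_real t)) * of_real t powr (z - 1))))"
    using a by (intro Bochner_Integration.integral_cong refl)
      (auto simp: indicator_def zero_less_mult_iff powr_times_real_left)
  also have "\<dots> = of_real a powr (z - 1) * (LINT t:{0<..}|lborel. exp (- (of_real a * of_real t)) * of_real t powr (z - 1))"
    unfolding set_lebesgue_integral_def by (rule integral_mult_right_zero)
  finally have "Gamma z = (of_real a * of_real a powr (z - 1)) * (LINT t:{0<..}|lborel. exp (- (of_real a * of_real t)) * of_real t powr (z - 1))"
    by (simp add: scaleR_conv_of_real mult.assoc)
  moreover have "of_real a * of_real a powr (z - 1) = of_real a powr z"
    using a by (simp add: powr_diff)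
  ultimately show ?thesis using a by (simp add: field_simps)
qed

text \<open>Both sides are holomorphic in \<open>p\<close> and agree for real \<open>p\<close>, so
  the identity theorem on a half-plane applies.\<close>

lemma laplace_powr:
  fixes z p :: complex
  assumes z: "Re z > 0" and p: "Re p > 0"
  shows "(LINT t:{0<..}|lborel. exp (- (p * of_real t)) * of_real t powr (z - 1)) = Gamma z / p powr z"
proof -
  \<comment> \<open>Half of the decay is moved into \<open>g\<close> to make it integrable; the
    half-plane \<open>Re p > e\<close> still contains the given \<open>p\<close>.\<close>
  define e where "e = Re p / 2"
  have e: "e > 0" "e < Re p" using p by (auto simp: e_def)
  define g where "g t = indicat_real {0<..} t *\<^sub>R (exp (- (of_real e * of_real t)) * complex_of_real t powr (z - 1))" for t
  \<comment> \<open>\<open>max 0 t\<close> makes the weight nonnegative everywhere and equals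
    \<open>t\<close> wherever \<open>g\<close> is nonzero.\<close>
  let ?L = "\<lambda>p. LBINT t. exp (- ((p - of_real e) * of_real (max 0 t))) * g t"
  have L: "?L p = (LINT t:{0<..}|lborel. exp (- (p * of_real t)) * of_real t powr (z - 1))" for p
    unfolding set_lebesgue_integral_def
    by (intro Bochner_Integration.integral_cong refl)
       (auto simp: g_def indicator_def exp_add[symmetric] mult.assoc[symmetric] algebra_simps)
  have "(\<lambda>z. LBINT t. exp (- (z * of_real (max 0 t))) * g t) analytic_on {z. Re z > 0}"
    using set_integrable_exp_powr[OF z, of "of_real e"] e
    by (intro laplace_analytic) (auto simp: g_def set_integrable_def)
  then have "(\<lambda>z. LBINT t. exp (- (z * of_real (max 0 t))) * g t) holomorphic_on {z. Re z > 0}"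
    by (rule analytic_imp_holomorphic)
  then have "((\<lambda>z. LBINT t. exp (- (z * of_real (max 0 t))) * g t) \<circ> (\<lambda>p. p - of_real e)) holomorphic_on {p. Re p > e}"
    by (intro holomorphic_on_compose_gen[of _ _ _ "{z. Re z > 0}"] holomorphic_intros) auto
  then have "?L holomorphic_on {p. Re p > e}" by (simp add: o_def)
  then have holo: "(\<lambda>p. ?L p - Gamma z / p powr z) holomorphic_on {p. Re p > e}"
    using e by (intro holomorphic_intros) (auto simp: complex_nonpos_Reals_iff powr_def)
  have "?L p - Gamma z / p powr z = 0"
    by (rule analytic_continuation[OF holo _ _ _ _ of_real_islimpt_greaterThan])
       (use e in \<open>auto simp: L laplace_powr_real[OF z] open_halfspace_Re_gt convex_connected convex_halfspace_Re_gt simp del: of_real_mult of_real_minus\<close>)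
  then show ?thesis by (simp add: L)
qed

text \<open>The norm of the integrand is the same integrand at the real parameters
  \<open>Re p\<close> and \<open>Re z\<close>; the cast to complex numbers allows
  \<open>laplace_powr\<close> to be reused.\<close>

lemma integral_norm_exp_powr:
  fixes z p :: complex
  assumes z: "Re z > 0" and p: "Re p > 0"
  shows "(LINT t:{0<..}|lborel. norm (exp (- (p * of_real t)) * of_real t powr (z - 1))) = Gamma (Re z) / Re p powr Re z"
proof -
  have "complex_of_real (LINT t:{0<..}|lborel. norm (exp (- (p * of_real t)) * of_real t powr (z - 1)))
    = (LBINT t. complex_of_real (indicat_real {0<..} t *\<^sub>R (norm (exp (- (p * of_real t)) * of_real t powr (z - 1)))))"
    unfolding set_lebesgue_integral_def by (rule integral_complex_of_real[symmetric])
  also have "\<dots> = (LINT t:{0<..}|lborel. exp (- (of_real (Re p) * of_real t)) * of_real t powr (of_real (Re z) - 1))"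
    unfolding set_lebesgue_integral_def
    by (intro Bochner_Integration.integral_cong refl)
       (auto simp: indicator_def norm_mult norm_powr_real_powr powr_of_real[symmetric] exp_of_real[symmetric])
  also have "\<dots> = complex_of_real (Gamma (Re z) / Re p powr Re z)"
    using z p by (subst laplace_powr) (auto simp: Gamma_complex_of_real powr_of_real)
  finally show ?thesis by (simp only: of_real_eq_iff)
qed

section \<open>Decay of the Gamma function in the imaginary direction\<close>

text \<open>Up to the factor \<open>pi * v\<close>, these are partial products of the sine product
  at the imaginary point \<open>\<i> * v\<close>. They increase, so they stay below the limit, whose
  norm is at most \<open>exp (pi * v)\<close>.\<close>

lemma prod_one_plus_squares_le:
  fixes u :: real
  assumes u: "0 \<le> u"
  shows "(\<Prod>k=1..n. 1 + u\<^sup>2 / (of_nat k)\<^sup>2) \<le> exp (pi * (1 + u))"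
proof -
  define v where "v = max 1 u"
  have v: "1 \<le> v" "u \<le> v" "v \<le> 1 + u" using u by (auto simp: v_def)
  let ?P = "\<lambda>n. pi * v * (\<Prod>k=1..n. 1 + v\<^sup>2 / (of_nat k)\<^sup>2)"
  have "(\<lambda>n. norm (of_real pi * (\<i> * of_real v) * (\<Prod>k=1..n. 1 - (\<i> * of_real v)^2 / of_nat k^2)))
    \<longlonglongrightarrow> norm (sin (of_real pi * (\<i> * of_real v)))"
    by (intro tendsto_norm sin_product_formula_complex)
  moreover have "norm (of_real pi * (\<i> * of_real v) * (\<Prod>k=1..n. 1 - (\<i> * of_real v)^2 / of_nat k^2)) = ?P n" for n
  proof -
    have "(\<Prod>k=1..n. 1 - (\<i> * of_real v)^2 / of_nat k^2) = complex_of_real (\<Prod>k=1..n. 1 + v\<^sup>2 / (of_nat k)\<^sup>2)"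
      by (simp add: power_mult_distrib)
    then show ?thesis using v
      by (simp only: norm_mult norm_of_real) (simp add: abs_mult abs_of_nonneg prod_nonneg)
  qed
  ultimately have lim: "?P \<longlonglongrightarrow> norm (sin (of_real pi * (\<i> * of_real v)))" by simp
  have "incseq ?P"
  proof (rule incseq_SucI)
    fix n
    have "(\<Prod>k=1..n. 1 + v\<^sup>2 / (of_nat k)\<^sup>2) * 1 \<le> (\<Prod>k=1..n. 1 + v\<^sup>2 / (of_nat k)\<^sup>2) * (1 + v\<^sup>2 / (of_nat (Suc n))\<^sup>2)"
      by (intro mult_left_mono prod_nonneg) auto
    then show "?P n \<le> ?P (Suc n)" using v by (intro mult_left_mono) (simp_all del: of_nat_Suc)
  qed
  then have "?P n \<le> norm (sin (of_real pi * (\<i> * of_real v)))" by (rule incseq_le[OF _ lim])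
  also have "\<dots> = norm (exp (of_real (- (pi * v))) - exp (complex_of_real (pi * v))) / 2"
    by (simp add: sin_exp_eq norm_mult norm_divide mult_ac)
  also have "\<dots> \<le> (exp (- (pi * v)) + exp (pi * v)) / 2"
    using norm_triangle_ineq4[of "exp (complex_of_real (- (pi * v)))" "exp (complex_of_real (pi * v))"]
    by (simp del: of_real_minus of_real_mult)
  also have "\<dots> \<le> exp (pi * v)" using v by (simp add: order_trans[of _ 0])
  finally have "?P n \<le> exp (pi * v)" .
  moreover have "1 * (\<Prod>k=1..n. 1 + v\<^sup>2 / (of_nat k)\<^sup>2) \<le> ?P n"
    using v pi_gt3 mult_mono[of 1 pi 1 v] by (intro mult_right_mono prod_nonneg) auto
  moreover have "(\<Prod>k=1..n. 1 + u\<^sup>2 / (of_nat k)\<^sup>2) \<le> (\<Prod>k=1..n. 1 + v\<^sup>2 / (of_nat k)\<^sup>2)"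
    using u v by (intro prod_mono) (auto intro!: divide_right_mono power_mono)
  moreover have "exp (pi * v) \<le> exp (pi * (1 + u))" using v by simp
  ultimately show ?thesis by linarith
qed

text \<open>In Euler's limit only the Pochhammer denominators at \<open>z\<close> and at
  \<open>Re z\<close> differ in norm. Their factors compare with ratio at most
  \<open>1 + u\<^sup>2 / (k + 1)\<^sup>2\<close>, and the product of these ratios is the sine
  product. The rate depends on \<open>d\<close> alone, so the bound is uniform along the parameters
  of the series.\<close>

lemma Gamma_Re_le_norm_Gamma:
  fixes z :: complex
  assumes d: "0 < d" "d \<le> 1" "d \<le> Re z"
  shows "Gamma (Re z) \<le> exp (pi * (1 + \<bar>Im z\<bar> / d)) * norm (Gamma z)"
proof -
  define x u where "x = Re z" and "u = \<bar>Im z\<bar> / d"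
  have x: "x > 0" "d \<le> x" and u: "u \<ge> 0" using d by (auto simp: x_def u_def)
  have factor: "norm (z + of_nat k) \<le> (x + of_nat k) * (1 + u\<^sup>2 / (of_nat (Suc k))\<^sup>2)" for k
  proof -
    define w where "w = x + of_nat k"
    \<comment> \<open>As \<open>d \<le> 1\<close>, \<open>x + k \<ge> d + d * k\<close>; this
      produces the shifted index \<open>Suc k\<close> and avoids division by zero at
      \<open>k = 0\<close>.\<close>
    have w: "w > 0" "d * real (Suc k) \<le> w"
      using x d mult_right_mono[of d 1 "real k"] by (auto simp: w_def algebra_simps)
    have "(Im z)\<^sup>2 = u\<^sup>2 * d\<^sup>2" using d by (simp add: u_def power_divide)
    also have "\<dots> * (real (Suc k))\<^sup>2 = u\<^sup>2 * (d * real (Suc k))\<^sup>2" by (simp add: power_mult_distrib)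
    also have "\<dots> \<le> u\<^sup>2 * w\<^sup>2" using w d by (intro mult_left_mono power_mono) auto
    finally have "(Im z)\<^sup>2 \<le> w\<^sup>2 * (u\<^sup>2 / (real (Suc k))\<^sup>2)"
      by (simp add: field_simps del: of_nat_Suc)
    moreover define c where "c = u\<^sup>2 / (real (Suc k))\<^sup>2"
    ultimately have im: "(Im z)\<^sup>2 \<le> w\<^sup>2 * c" by simp
    have "0 \<le> c" by (simp add: c_def)
    have "(norm (z + of_nat k))\<^sup>2 = w\<^sup>2 + (Im z)\<^sup>2" by (simp add: cmod_power2 w_def x_def)
    also have "\<dots> \<le> w\<^sup>2 * (1 + c)" using im by (simp add: distrib_left)
    also have "\<dots> \<le> w\<^sup>2 * (1 + c)\<^sup>2"
    proof (rule mult_left_mono)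
      have "0 \<le> c * c" by simp
      then show "1 + c \<le> (1 + c)\<^sup>2" using \<open>0 \<le> c\<close> by (simp only: power2_sum power2_eq_square) simp
    qed simp
    also have "w\<^sup>2 * (1 + c)\<^sup>2 = (w * (1 + c))\<^sup>2" by (rule power_mult_distrib[symmetric])
    finally have "(norm (z + of_nat k))\<^sup>2 \<le> (w * (1 + c))\<^sup>2" .
    then have "norm (z + of_nat k) \<le> w * (1 + c)"
      by (rule power2_le_imp_le) (use w \<open>0 \<le> c\<close> in simp)
    then show ?thesis by (simp only: w_def c_def)
  qed
  have poch: "norm (pochhammer z (Suc n)) \<le> pochhammer x (Suc n) * exp (pi * (1 + u))" for n
  proof -
    have "norm (pochhammer z (Suc n)) = (\<Prod>k=0..<Suc n. norm (z + of_nat k))"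
      by (simp add: pochhammer_prod prod_norm)
    also have "\<dots> \<le> (\<Prod>k=0..<Suc n. (x + of_nat k) * (1 + u\<^sup>2 / (of_nat (Suc k))\<^sup>2))"
      using factor by (intro prod_mono) auto
    also have "\<dots> = pochhammer x (Suc n) * (\<Prod>k=0..<Suc n. 1 + u\<^sup>2 / (of_nat (Suc k))\<^sup>2)"
      by (simp only: prod.distrib pochhammer_prod)
    also have "(\<Prod>k=0..<Suc n. 1 + u\<^sup>2 / (of_nat (Suc k))\<^sup>2) = (\<Prod>k=1..Suc n. 1 + u\<^sup>2 / (of_nat k)\<^sup>2)"
      by (rule prod.reindex_bij_witness[of _ "\<lambda>k. k - 1" Suc]) auto
    also have "pochhammer x (Suc n) * (\<Prod>k=1..Suc n. 1 + u\<^sup>2 / (of_nat k)\<^sup>2) \<le> pochhammer x (Suc n) * exp (pi * (1 + u))"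
      using x by (intro mult_left_mono prod_one_plus_squares_le u pochhammer_nonneg) auto
    finally show ?thesis .
  qed
  have "Gamma_series x n \<le> exp (pi * (1 + u)) * norm (Gamma_series z n)" for n
  proof -
    have pz: "norm (pochhammer z (Suc n)) > 0"
    proof -
      have "z \<noteq> - of_nat k" for k using d by (auto simp: complex_eq_iff)
      then show ?thesis by (simp add: pochhammer_eq_0_iff)
    qed
    have px: "pochhammer x (Suc n) > 0" using x by (simp add: pochhammer_pos)
    let ?F = "fact n * exp (x * ln (real n))"
    have "norm (Gamma_series z n) = ?F / norm (pochhammer z (Suc n))"
      by (simp add: Gamma_series_def norm_mult norm_divide x_def)
    moreover have "?F / (pochhammer x (Suc n) * exp (pi * (1 + u))) \<le> ?F / norm (pochhammer z (Suc n))"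
      using poch[of n] pz px by (intro divide_left_mono) auto
    then have "exp (pi * (1 + u)) * (?F / (pochhammer x (Suc n) * exp (pi * (1 + u)))) \<le>
        exp (pi * (1 + u)) * (?F / norm (pochhammer z (Suc n)))"
      by (rule mult_left_mono) simp
    moreover have "Gamma_series x n = exp (pi * (1 + u)) * (?F / (pochhammer x (Suc n) * exp (pi * (1 + u))))"
      by (simp add: Gamma_series_def)
    ultimately show ?thesis by simp
  qed
  then have "Gamma x \<le> exp (pi * (1 + u)) * norm (Gamma z)"
    by (intro LIMSEQ_le[OF Gamma_series_LIMSEQ tendsto_mult[OF tendsto_const tendsto_norm[OF Gamma_series_LIMSEQ]]]) auto
  then show ?thesis by (simp add: x_def u_def)
qed

subsection \<open>Double series\<close>

lemma
  fixes f g :: "real \<Rightarrow> 'a::{real_normed_field, banach, second_countable_topology}"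
  assumes f: "integrable lborel f" and g: "integrable lborel g"
  shows integrable_lborel_times: "integrable lborel (\<lambda>x. f (fst x) * g (snd x))"
    and integral_lborel_times: "(LBINT x. f (fst x) * g (snd x)) = (LBINT x. f x) * (LBINT y. g y)"
proof -
  have [measurable]: "f \<in> borel_measurable borel" "g \<in> borel_measurable borel"
    using borel_measurable_integrable[OF f] borel_measurable_integrable[OF g] by simp_all
  have *: "integrable (lborel \<Otimes>\<^sub>M lborel) (\<lambda>x. f (fst x) * g (snd x))"
    using f g by (intro lborel_pair.Fubini_integrable) (auto simp: norm_mult)
  then show "integrable lborel (\<lambda>x. f (fst x) * g (snd x))" by (simp add: lborel_prod)
  show "(LBINT x. f (fst x) * g (snd x)) = (LBINT x. f x) * (LBINT y. g y)"
    using lborel_pair.integral_fst'[OF *] by (simp add: lborel_prod)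
qed

text \<open>Termwise integration is applied twice, first over \<open>r\<close> and then over
  \<open>s\<close>. Summing the geometric bound over \<open>r\<close> leaves
  \<open>C / (1 - b) * a ^ s\<close>, again geometric, for the outer series.\<close>

lemma
  fixes T :: "nat \<Rightarrow> nat \<Rightarrow> 'a \<Rightarrow> complex"
  assumes int: "\<And>s r. integrable M (T s r)"
    and bound: "\<And>s r. (\<integral>x. norm (T s r x) \<partial>M) \<le> C * a ^ s * b ^ r"
    and ab: "0 \<le> a" "a < 1" "0 \<le> b" "b < 1"
  shows AE_summable_double: "AE x in M. (\<forall>s. summable (\<lambda>r. T s r x)) \<and> summable (\<lambda>s. \<Sum>r. T s r x)"
    and integrable_double_suminf: "integrable M (\<lambda>x. \<Sum>s. \<Sum>r. T s r x)"
    and integral_double_suminf: "(\<integral>x. (\<Sum>s. \<Sum>r. T s r x) \<partial>M) = (\<Sum>s. \<Sum>r. \<integral>x. T s r x \<partial>M)"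
proof -
  have geo: "summable (\<lambda>r. c * b ^ r)" "summable (\<lambda>r. c * a ^ r)" for c
    using ab by (simp_all add: summable_mult summable_geometric)
  have sum1: "summable (\<lambda>r. \<integral>x. norm (T s r x) \<partial>M)" for s
    by (rule summable_comparison_test'[of "\<lambda>r. C * a ^ s * b ^ r" 0]) (use bound[of s] geo in auto)
  have ae1: "AE x in M. summable (\<lambda>r. norm (T s r x))" for s
    by (rule AE_summable_norm_of_summable_integral[OF int sum1])
  have int1: "integrable M (\<lambda>x. \<Sum>r. T s r x)" for s
    by (rule integrable_suminf[OF int ae1 sum1])
  have bound1: "(\<integral>x. norm (\<Sum>r. T s r x) \<partial>M) \<le> (C / (1 - b)) * a ^ s" for s
  proof -
    have sum1': "summable (\<lambda>r. \<integral>x. norm (norm (T s r x)) \<partial>M)" using sum1 by simp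
    have ae1': "AE x in M. summable (\<lambda>r. norm (norm (T s r x)))" using ae1 by simp
    note n = integrable_norm[OF int]
    have "(\<integral>x. norm (\<Sum>r. T s r x) \<partial>M) \<le> (\<integral>x. (\<Sum>r. norm (T s r x)) \<partial>M)"
      using ae1[of s]
      by (intro integral_mono_AE integrable_norm int1 integrable_suminf[OF n ae1' sum1'])
         (auto intro: summable_norm elim: eventually_mono)
    also have "\<dots> = (\<Sum>r. \<integral>x. norm (T s r x) \<partial>M)"
      by (rule integral_suminf[OF n ae1' sum1'])
    also have "\<dots> \<le> (\<Sum>r. C * a ^ s * b ^ r)"
      by (rule suminf_le[OF bound sum1 geo(1)])
    also have "\<dots> = (C / (1 - b)) * a ^ s"
      using ab by (subst suminf_mult) (auto simp: suminf_geometric summable_geometric)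
    finally show ?thesis .
  qed
  have sum2: "summable (\<lambda>s. \<integral>x. norm (\<Sum>r. T s r x) \<partial>M)"
    by (rule summable_comparison_test'[of "\<lambda>s. C / (1 - b) * a ^ s" 0]) (use bound1 geo in auto)
  have ae2: "AE x in M. summable (\<lambda>s. norm (\<Sum>r. T s r x))"
    by (rule AE_summable_norm_of_summable_integral[OF int1 sum2])
  have "AE x in M. \<forall>s. summable (\<lambda>r. norm (T s r x))" using ae1 by (simp add: AE_all_countable)
  with ae2 show "AE x in M. (\<forall>s. summable (\<lambda>r. T s r x)) \<and> summable (\<lambda>s. \<Sum>r. T s r x)"
    by eventually_elim (auto intro: summable_norm_cancel)
  show "integrable M (\<lambda>x. \<Sum>s. \<Sum>r. T s r x)" by (rule integrable_suminf[OF int1 ae2 sum2])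
  show "(\<integral>x. (\<Sum>s. \<Sum>r. T s r x) \<partial>M) = (\<Sum>s. \<Sum>r. \<integral>x. T s r x \<partial>M)"
    by (simp add: integral_suminf[OF int1 ae2 sum2] integral_suminf[OF int ae1 sum1])
qed

section \<open>Growth of Pochhammer symbols and the binomial series\<close>

lemma norm_pochhammer_le: "norm (pochhammer (a::complex) n) \<le> pochhammer (norm a) n"
  unfolding pochhammer_prod prod_norm[symmetric]
  by (intro prod_mono) (auto intro: order_trans[OF norm_triangle_ineq])

text \<open>Each factor satisfies \<open>x + n \<le> (1 + x) * (1 + n)\<close>. This suffices for a
  fixed parameter such as \<open>\<gamma>1 / 2\<close>.\<close>

lemma pochhammer_le_power_fact:
  assumes "0 \<le> (x::real)"
  shows "pochhammer x n \<le> (1 + x) ^ n * fact n"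
proof (induction n)
  case (Suc n)
  have "pochhammer x n * (x + of_nat n) \<le> ((1 + x) ^ n * fact n) * ((1 + x) * (1 + of_nat n))"
    using assms by (intro mult_mono Suc) (auto simp: algebra_simps)
  then show ?case by (simp add: pochhammer_Suc algebra_simps)
qed simp

text \<open>For the integer parameter \<open>m + 1\<close> the quotient by \<open>fact r\<close> is
  a binomial coefficient, at most \<open>2 ^ (m + r)\<close>. Unlike a power of
  \<open>1 + x\<close>, this stays geometric in both indices when \<open>m\<close> grows with
  \<open>s\<close>, as for the parameter \<open>\<gamma>2 + of_nat s\<close>.\<close>

lemma pochhammer_le_two_power:
  assumes "0 \<le> x" "x \<le> real (Suc m)"
  shows "pochhammer x r \<le> 2 ^ (m + r) * fact r"
proof -
  have f: "pochhammer (real (Suc m)) r * fact m = fact (m + r)"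
  proof (induction r)
    case (Suc r)
    have "pochhammer (real (Suc m)) (Suc r) * fact m = (pochhammer (real (Suc m)) r * fact m) * real (Suc (m + r))"
      by (simp add: pochhammer_Suc)
    then show ?case by (simp only: Suc) simp
  qed simp
  have "pochhammer x r \<le> pochhammer (real (Suc m)) r"
    unfolding pochhammer_prod using assms by (intro prod_mono) auto
  also have "\<dots> = real ((m + r) choose r) * fact r"
    using f by (simp add: binomial_fact field_simps)
  also have "real ((m + r) choose r) \<le> 2 ^ (m + r)"
    using binomial_le_pow2[of "m + r" r] by (metis of_nat_le_iff of_nat_numeral of_nat_power)
  finally show ?thesis by simp
qed

text \<open>The generalised binomial series with exponent \<open>- a\<close> at \<open>- w\<close>;
  the two alternating signs cancel.\<close>

lemma sums_pochhammer_power: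
  fixes w a :: complex
  assumes "norm w < 1"
  shows "(\<lambda>n. pochhammer a n / fact n * w ^ n) sums (1 - w) powr (- a)"
proof -
  have "((- a) gchoose n) * (- w) ^ n = pochhammer a n / fact n * w ^ n" for n
  proof -
    have "(- 1) ^ n * (- 1) ^ n = (1::complex)" by (simp flip: power_mult_distrib)
    then show ?thesis by (simp add: gbinomial_pochhammer power_minus[of w])
  qed
  then show ?thesis using gen_binomial_complex[of "- w" "- a"] assms by simp
qed

lemma powr_add_mult_of_nat:
  fixes z a b :: complex
  assumes "z \<noteq> 0"
  shows "z powr (a + b * of_nat n) = z powr a * (z powr b) ^ n"
  using assms by (simp add: powr_def exp_add[symmetric] exp_of_nat_mult[symmetric] algebra_simps)

subsection \<open>The transform for large real parts\<close>

definition hk_weighted ::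
  "complex \<Rightarrow> complex \<Rightarrow> complex \<Rightarrow> complex \<Rightarrow> complex \<Rightarrow> complex \<Rightarrow> complex \<Rightarrow> real \<Rightarrow> real \<Rightarrow> complex"
where
  "hk_weighted \<gamma>1 \<gamma>2 \<kappa> \<rho> \<Upsilon> \<nu>1 \<nu>2 X Y = of_real X powr (\<kappa> - 1) * of_real Y powr (\<rho> - 1) *
     HK_mittag_leffler \<gamma>1 \<gamma>2 ((\<gamma>1 + 1) / 2) \<gamma>2 \<kappa> \<rho> \<Upsilon> (\<nu>1 * of_real X) (\<nu>2 * of_real Y)"

text \<open>What remains of a series coefficient after the duplication formula cancels
  \<open>\<gamma>3\<close> and \<open>\<gamma>4\<close>; \<open>w\<close> stands for
  \<open>\<nu>2 powr \<Upsilon>\<close>.\<close>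

definition hk_coeff ::
  "complex \<Rightarrow> complex \<Rightarrow> complex \<Rightarrow> complex \<Rightarrow> complex \<Rightarrow> complex \<Rightarrow> complex \<Rightarrow> nat \<Rightarrow> nat \<Rightarrow> complex"
where
  "hk_coeff \<gamma>1 \<gamma>2 \<kappa> \<rho> \<Upsilon> \<nu>1 w s r =
     pochhammer (\<gamma>1 / 2) s / fact s * (4 * \<nu>1) ^ s * (pochhammer (\<gamma>2 + of_nat s) r / fact r * w ^ r) /
     (Gamma (\<kappa> + of_nat s) * Gamma (\<rho> + \<Upsilon> * of_nat r))"

text \<open>A single integral over the quadrant, to which termwise integration and dominated
  convergence apply directly; Fubini links it to the iterated \<open>double_laplace\<close>.\<close>

definition quadrant_laplace :: "(real \<Rightarrow> real \<Rightarrow> complex) \<Rightarrow> complex \<Rightarrow> complex \<Rightarrow> complex" where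
  "quadrant_laplace h p q =
     (LINT x:{0<..} \<times> {0<..}|lborel. exp (- (p * of_real (fst x) + q * of_real (snd x))) * h (fst x) (snd x))"

lemma double_laplace_exists_iff:
  "double_laplace_exists h p q \<longleftrightarrow> set_integrable lborel ({0<..} \<times> {0<..})
     (\<lambda>x. exp (- (p * of_real (fst x) + q * of_real (snd x))) * h (fst x) (snd x))"
  by (simp add: double_laplace_exists_def case_prod_unfold)

lemma double_laplace_eq_quadrant_laplace:
  assumes "double_laplace_exists h p q"
  shows "double_laplace h p q = quadrant_laplace h p q"
proof -
  let ?f = "\<lambda>x y. indicat_real {0<..} y *\<^sub>R (indicat_real {0<..} x *\<^sub>R (exp (- (p * of_real x + q * of_real y)) * h x y))"
  have eq: "(\<lambda>(x, y). ?f x y) = (\<lambda>x. indicat_real ({0<..} \<times> {0<..}) x *\<^sub>R (exp (- (p * of_real (fst x) + q * of_real (snd x))) * h (fst x) (snd x)))"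
    by (auto simp: indicator_def fun_eq_iff)
  have "integrable (lborel \<Otimes>\<^sub>M lborel) (\<lambda>(x, y). ?f x y)"
    using assms unfolding eq double_laplace_exists_iff set_integrable_def lborel_prod .
  from lborel_pair.integral_snd[OF this]
  have "(LBINT y. LBINT x. ?f x y) = quadrant_laplace h p q"
    unfolding eq quadrant_laplace_def set_lebesgue_integral_def lborel_prod .
  moreover have "(LBINT x. ?f x y) = indicat_real {0<..} y *\<^sub>R
      (LBINT x. indicat_real {0<..} x *\<^sub>R (exp (- (p * of_real x + q * of_real y)) * h x y))" for y
    by (cases "y > 0") auto
  ultimately show ?thesis
    unfolding double_laplace_def set_lebesgue_integral_def by (simp only:)
qed

lemma pochhammer_ne_zero:
  fixes a :: complex
  assumes "Re a > 0"
  shows "pochhammer a n \<noteq> 0"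
proof -
  have "a \<noteq> - of_nat k" for k using assms by (auto simp: complex_eq_iff)
  then show ?thesis by (simp add: pochhammer_eq_0_iff)
qed

lemma Gamma_ne_zero:
  fixes a :: complex
  assumes "Re a > 0"
  shows "Gamma a \<noteq> 0"
  using assms by (auto simp: Gamma_eq_zero_iff elim!: nonpos_Ints_cases)

text \<open>The duplication formula for \<open>pochhammer \<gamma>1 (2 * s)\<close> and the
  splitting of \<open>pochhammer \<gamma>2 (s + r)\<close> cancel the denominators. Positivity of
  \<open>Y\<close> permits splitting the principal power of \<open>\<nu>2 * Y\<close>.\<close>

lemma hk_term_eq:
  fixes \<gamma>1 \<gamma>2 :: complex and X Y :: real
  assumes g: "Re \<gamma>1 > 0" "Re \<gamma>2 > 0" and X: "X > 0" and Y: "Y > 0"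
  shows "of_real X powr (\<kappa> - 1) * of_real Y powr (\<rho> - 1) *
    (pochhammer \<gamma>1 (2 * s) * pochhammer \<gamma>2 (s + r) * (\<nu>1 * of_real X) ^ s * ((\<nu>2 * of_real Y) powr \<Upsilon>) ^ r /
       (pochhammer ((\<gamma>1 + 1) / 2) s * pochhammer \<gamma>2 s * Gamma (\<kappa> + of_nat s) *
        Gamma (\<rho> + \<Upsilon> * of_nat r) * fact r * fact s))
    = hk_coeff \<gamma>1 \<gamma>2 \<kappa> \<rho> \<Upsilon> \<nu>1 (\<nu>2 powr \<Upsilon>) s r *
      (of_real X powr (\<kappa> + of_nat s - 1) * of_real Y powr (\<rho> + \<Upsilon> * of_nat r - 1))"
proof -
  have Xp: "of_real X powr (\<kappa> + of_nat s - 1) = of_real X powr (\<kappa> - 1) * complex_of_real X ^ s"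
    using X powr_add_mult_of_nat[of "of_real X" "\<kappa> - 1" 1 s] by (simp add: algebra_simps)
  have Yp: "of_real Y powr (\<rho> + \<Upsilon> * of_nat r - 1) = of_real Y powr (\<rho> - 1) * (complex_of_real Y powr \<Upsilon>) ^ r"
    using Y powr_add_mult_of_nat[of "of_real Y" "\<rho> - 1" \<Upsilon> r] by (simp add: algebra_simps)
  have Yv: "(\<nu>2 * of_real Y) powr \<Upsilon> = \<nu>2 powr \<Upsilon> * of_real Y powr \<Upsilon>"
    using Y powr_times_real_left[of "of_real Y" \<nu>2 \<Upsilon>] by (simp add: mult.commute)
  have p1: "pochhammer \<gamma>1 (2 * s) = 4 ^ s * pochhammer (\<gamma>1 / 2) s * pochhammer ((\<gamma>1 + 1) / 2) s"
    using pochhammer_double[of "\<gamma>1 / 2" s] by (simp add: power_mult add_divide_distrib)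
  have p2: "pochhammer \<gamma>2 (s + r) = pochhammer \<gamma>2 s * pochhammer (\<gamma>2 + of_nat s) r"
    by (rule pochhammer_product')
  have "pochhammer ((\<gamma>1 + 1) / 2) s \<noteq> 0" "pochhammer \<gamma>2 s \<noteq> 0"
    using g by (auto intro!: pochhammer_ne_zero)
  then show ?thesis
    unfolding Xp Yp Yv p1 p2 hk_coeff_def by (simp add: power_mult_distrib mult_ac)
qed

text \<open>Absolute integration yields \<open>Gamma\<close> at real parts, while the coefficient
  carries norms of complex \<open>Gamma\<close> values in its denominator;
  \<open>Gamma_Re_le_norm_Gamma\<close> cancels them. The constants \<open>d\<close> and
  \<open>e\<close> are independent of \<open>s\<close> and \<open>r\<close>, so a geometric bound in
  both indices remains.\<close>

lemma integral_norm_hk_term_le: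
  fixes \<gamma>1 \<gamma>2 \<kappa> \<rho> \<Upsilon> \<nu>1 w p q :: complex
  assumes k: "Re \<kappa> > 0" "Re \<rho> > 0" "Re \<Upsilon> > 0" and d: "d = min 1 (Re \<kappa>)" "e = min 1 (Re \<rho>)"
    and m: "norm \<gamma>2 \<le> real m" and pq: "Re p > 0" "Re q > 0"
  shows "norm (hk_coeff \<gamma>1 \<gamma>2 \<kappa> \<rho> \<Upsilon> \<nu>1 w s r) * (Gamma (Re \<kappa> + real s) / Re p powr (Re \<kappa> + real s)) *
      (Gamma (Re \<rho> + Re \<Upsilon> * real r) / Re q powr (Re \<rho> + Re \<Upsilon> * real r)) \<le>
    2 ^ m * exp (pi * (1 + \<bar>Im \<kappa>\<bar> / d)) * exp (pi * (1 + \<bar>Im \<rho>\<bar> / e)) / (Re p powr Re \<kappa> * Re q powr Re \<rho>)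
      * (8 * (1 + norm (\<gamma>1 / 2)) * norm \<nu>1 / Re p) ^ s
      * (2 * norm w * exp (pi * \<bar>Im \<Upsilon>\<bar> / e) / Re q powr Re \<Upsilon>) ^ r"
proof -
  define Gs Gr where "Gs = norm (Gamma (\<kappa> + of_nat s))" and "Gr = norm (Gamma (\<rho> + \<Upsilon> * of_nat r))"
  define A B E where "A = exp (pi * (1 + \<bar>Im \<kappa>\<bar> / d))" and "B = exp (pi * (1 + \<bar>Im \<rho>\<bar> / e))"
    and "E = exp (pi * \<bar>Im \<Upsilon>\<bar> / e)"
  define g where "g = 1 + norm (\<gamma>1 / 2)"
  define P Q where "P = Re p powr Re \<kappa>" and "Q = Re q powr Re \<rho>"
  define b where "b = Re q powr Re \<Upsilon>"
  have de: "0 < d" "d \<le> 1" "d \<le> Re \<kappa>" "0 < e" "e \<le> 1" "e \<le> Re \<rho>" using k d by auto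
  have G: "Gs > 0" "Gr > 0"
    unfolding Gs_def Gr_def using k by (auto intro!: Gamma_ne_zero add_pos_nonneg)
  have pos: "A > 0" "B > 0" "E > 0" "g > 0" "P > 0" "Q > 0" "b > 0" using pq by (simp_all add: A_def B_def E_def g_def P_def Q_def b_def add_pos_nonneg)
  have args: "0 < Re \<kappa> + real s" "0 < Re \<rho> + Re \<Upsilon> * real r"
    using k by (simp_all add: add_pos_nonneg)
  have 1: "Gamma (Re \<kappa> + real s) \<le> A * Gs"
    using Gamma_Re_le_norm_Gamma[of d "\<kappa> + of_nat s"] de by (simp add: A_def Gs_def)
  have "Gamma (Re \<rho> + Re \<Upsilon> * real r) \<le> exp (pi * (1 + \<bar>Im (\<rho> + \<Upsilon> * of_nat r)\<bar> / e)) * Gr"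
    using Gamma_Re_le_norm_Gamma[of e "\<rho> + \<Upsilon> * of_nat r"] de k by (simp add: Gr_def add_increasing2)
  \<comment> \<open>The imaginary part grows at most linearly in \<open>r\<close>, so a complex
    \<open>\<Upsilon>\<close> costs only a further geometric factor \<open>E ^ r\<close>.\<close>
  also have "exp (pi * (1 + \<bar>Im (\<rho> + \<Upsilon> * of_nat r)\<bar> / e)) \<le> B * E ^ r"
  proof -
    have "\<bar>Im (\<rho> + \<Upsilon> * of_nat r)\<bar> \<le> \<bar>Im \<rho>\<bar> + \<bar>Im \<Upsilon>\<bar> * real r"
      using abs_triangle_ineq[of "Im \<rho>" "Im \<Upsilon> * real r"] by (simp add: abs_mult)
    then have "pi * (1 + \<bar>Im (\<rho> + \<Upsilon> * of_nat r)\<bar> / e) \<le> pi * (1 + (\<bar>Im \<rho>\<bar> + \<bar>Im \<Upsilon>\<bar> * real r) / e)"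
      using de by (intro mult_left_mono add_left_mono divide_right_mono) auto
    also have "\<dots> = pi * (1 + \<bar>Im \<rho>\<bar> / e) + real r * (pi * \<bar>Im \<Upsilon>\<bar> / e)"
      using de by (simp add: field_simps)
    finally show ?thesis by (simp add: B_def E_def exp_add[symmetric] exp_of_nat_mult[symmetric])
  qed
  finally have 2: "Gamma (Re \<rho> + Re \<Upsilon> * real r) \<le> B * E ^ r * Gr" using G by simp
  have 3: "norm (pochhammer (\<gamma>1 / 2) s / fact s) \<le> g ^ s"
  proof -
    have "norm (pochhammer (\<gamma>1 / 2) s) \<le> g ^ s * fact s"
      unfolding g_def by (rule order_trans[OF norm_pochhammer_le pochhammer_le_power_fact]) simp
    then show ?thesis by (simp add: norm_divide pos_divide_le_eq)
  qed
  have 4: "norm (pochhammer (\<gamma>2 + of_nat s) r / fact r) \<le> 2 ^ (m + s + r)"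
  proof -
    have "norm (\<gamma>2 + of_nat s) \<le> real (Suc (m + s))"
      using norm_triangle_ineq[of \<gamma>2 "of_nat s"] m by simp
    then have "norm (pochhammer (\<gamma>2 + of_nat s) r) \<le> 2 ^ (m + s + r) * fact r"
      by (intro order_trans[OF norm_pochhammer_le pochhammer_le_two_power]) simp_all
    then show ?thesis by (simp add: norm_divide pos_divide_le_eq)
  qed
  have "norm (hk_coeff \<gamma>1 \<gamma>2 \<kappa> \<rho> \<Upsilon> \<nu>1 w s r)
      = norm (pochhammer (\<gamma>1 / 2) s / fact s) * (4 * norm \<nu>1) ^ s * (norm (pochhammer (\<gamma>2 + of_nat s) r / fact r) * norm w ^ r) / (Gs * Gr)"
    by (simp add: hk_coeff_def norm_mult norm_divide norm_power Gs_def Gr_def power_mult_distrib)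
  also have "\<dots> \<le> g ^ s * (4 * norm \<nu>1) ^ s * (2 ^ (m + s + r) * norm w ^ r) / (Gs * Gr)"
    using G pos by (intro divide_right_mono mult_mono 3 4) auto
  finally have c: "norm (hk_coeff \<gamma>1 \<gamma>2 \<kappa> \<rho> \<Upsilon> \<nu>1 w s r) \<le> g ^ s * (4 * norm \<nu>1) ^ s * (2 ^ (m + s + r) * norm w ^ r) / (Gs * Gr)" .
  have Pp: "Re p powr (Re \<kappa> + real s) = P * Re p ^ s"
    using pq by (simp add: P_def powr_add powr_realpow)
  have Qp: "Re q powr (Re \<rho> + Re \<Upsilon> * real r) = Q * b ^ r"
    using pq by (simp add: Q_def b_def powr_add powr_powr[symmetric] powr_realpow)
  have "norm (hk_coeff \<gamma>1 \<gamma>2 \<kappa> \<rho> \<Upsilon> \<nu>1 w s r) * (Gamma (Re \<kappa> + real s) / Re p powr (Re \<kappa> + real s)) *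
      (Gamma (Re \<rho> + Re \<Upsilon> * real r) / Re q powr (Re \<rho> + Re \<Upsilon> * real r)) \<le>
     (g ^ s * (4 * norm \<nu>1) ^ s * (2 ^ (m + s + r) * norm w ^ r) / (Gs * Gr)) * (A * Gs / (P * Re p ^ s)) * (B * E ^ r * Gr / (Q * b ^ r))"
    unfolding Pp Qp using G pos pq args[THEN Gamma_real_nonneg]
    by (intro mult_mono divide_right_mono c 1 2) auto
  also have "\<dots> = 2 ^ m * A * B / (P * Q) * (8 * g * norm \<nu>1 / Re p) ^ s * (2 * norm w * E / b) ^ r"
  proof -
    \<comment> \<open>The 4 stems from the duplication formula, the 2 from the binomial bound in
      \<open>4\<close>.\<close>
    have "(8::real) ^ s = 4 ^ s * 2 ^ s" by (simp flip: power_mult_distrib)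
    then show ?thesis using G by (simp add: power_mult_distrib power_divide power_add field_simps)
  qed
  finally show ?thesis unfolding A_def B_def E_def g_def P_def Q_def b_def .
qed

text \<open>The integrand is later identified with its series only almost everywhere, and
  \<open>lborel\<close> is not complete, so measurability is shown separately. On the quadrant the
  power of \<open>\<nu>2 * Y\<close> is split so that only powers of real variables occur.\<close>

lemma borel_measurable_hk_integrand:
  "(\<lambda>x. indicat_real ({0<..} \<times> {0<..}) x *\<^sub>R (exp (- (p * of_real (fst x) + q * of_real (snd x))) *
      hk_weighted \<gamma>1 \<gamma>2 \<kappa> \<rho> \<Upsilon> \<nu>1 \<nu>2 (fst x) (snd x))) \<in> borel_measurable lborel"
    (is "?f \<in> _")
proof -
  have "?f = (\<lambda>x. indicat_real ({0<..} \<times> {0<..}) x *\<^sub>R (exp (- (p * of_real (fst x) + q * of_real (snd x))) *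
      (of_real (fst x) powr (\<kappa> - 1) * of_real (snd x) powr (\<rho> - 1) *
       (\<Sum>s. \<Sum>r. pochhammer \<gamma>1 (2 * s) * pochhammer \<gamma>2 (s + r) * (\<nu>1 * of_real (fst x)) ^ s *
          (of_real (snd x) powr \<Upsilon> * \<nu>2 powr \<Upsilon>) ^ r /
       (pochhammer ((\<gamma>1 + 1) / 2) s * pochhammer \<gamma>2 s * Gamma (\<kappa> + of_nat s) *
        Gamma (\<rho> + \<Upsilon> * of_nat r) * fact r * fact s)))))"
  proof
    fix x :: "real \<times> real"
    show "?f x = indicat_real ({0<..} \<times> {0<..}) x *\<^sub>R (exp (- (p * of_real (fst x) + q * of_real (snd x))) *
      (of_real (fst x) powr (\<kappa> - 1) * of_real (snd x) powr (\<rho> - 1) *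
       (\<Sum>s. \<Sum>r. pochhammer \<gamma>1 (2 * s) * pochhammer \<gamma>2 (s + r) * (\<nu>1 * of_real (fst x)) ^ s *
          (of_real (snd x) powr \<Upsilon> * \<nu>2 powr \<Upsilon>) ^ r /
       (pochhammer ((\<gamma>1 + 1) / 2) s * pochhammer \<gamma>2 s * Gamma (\<kappa> + of_nat s) *
        Gamma (\<rho> + \<Upsilon> * of_nat r) * fact r * fact s))))"
    proof (cases "x \<in> {0<..} \<times> {0<..}")
      case True
      then have "(\<nu>2 * of_real (snd x)) powr \<Upsilon> = of_real (snd x) powr \<Upsilon> * \<nu>2 powr \<Upsilon>"
        using powr_times_real_left[of "of_real (snd x)" \<nu>2 \<Upsilon>] by (auto simp: mult.commute)
      then show ?thesis unfolding hk_weighted_def HK_mittag_leffler_def by (simp only:)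
    qed simp
  qed
  moreover have "\<dots> \<in> borel_measurable (lborel \<Otimes>\<^sub>M lborel)" by measurable
  ultimately show ?thesis by (simp only: lborel_prod)
qed

text \<open>Beyond the thresholds \<open>P\<close> and \<open>Q\<close> both geometric ratios are
  below 1, which justifies termwise integration of the double series.\<close>

lemma hk_double_series:
  fixes \<gamma>1 \<gamma>2 \<kappa> \<rho> \<Upsilon> \<nu>1 \<nu>2 :: complex
  assumes pos: "Re \<gamma>1 > 0" "Re \<gamma>2 > 0" "Re \<kappa> > 0" "Re \<rho> > 0" "Re \<Upsilon> > 0"
  obtains P Q :: real where "0 \<le> P" "0 \<le> Q"
    "\<And>p q. Re p > P \<Longrightarrow> Re q > Q \<Longrightarrow> double_laplace_exists (hk_weighted \<gamma>1 \<gamma>2 \<kappa> \<rho> \<Upsilon> \<nu>1 \<nu>2) p q \<and>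
      quadrant_laplace (hk_weighted \<gamma>1 \<gamma>2 \<kappa> \<rho> \<Upsilon> \<nu>1 \<nu>2) p q =
        (\<Sum>s. \<Sum>r. hk_coeff \<gamma>1 \<gamma>2 \<kappa> \<rho> \<Upsilon> \<nu>1 (\<nu>2 powr \<Upsilon>) s r *
           (Gamma (\<kappa> + of_nat s) / p powr (\<kappa> + of_nat s) *
            (Gamma (\<rho> + \<Upsilon> * of_nat r) / q powr (\<rho> + \<Upsilon> * of_nat r))))"
proof -
  define w where "w = \<nu>2 powr \<Upsilon>"
  define h where "h = hk_weighted \<gamma>1 \<gamma>2 \<kappa> \<rho> \<Upsilon> \<nu>1 \<nu>2"
  define c where "c = hk_coeff \<gamma>1 \<gamma>2 \<kappa> \<rho> \<Upsilon> \<nu>1 w"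
  define d e where "d = min 1 (Re \<kappa>)" and "e = min 1 (Re \<rho>)"
  obtain m where m: "norm \<gamma>2 \<le> real m" using real_arch_simple by blast
  define P where "P = 8 * (1 + norm (\<gamma>1 / 2)) * norm \<nu>1"
  define Q0 where "Q0 = 2 * norm w * exp (pi * \<bar>Im \<Upsilon>\<bar> / e)"
  \<comment> \<open>Chosen so that \<open>Re q > Q\<close> gives
    \<open>Q0 < Re q powr Re \<Upsilon>\<close>, that is, ratio \<open>b < 1\<close>.\<close>
  define Q where "Q = Q0 powr (1 / Re \<Upsilon>)"
  have PQ: "0 \<le> P" "0 \<le> Q" "0 \<le> Q0" by (simp_all add: P_def Q_def Q0_def)
  show thesis
  proof (rule that[OF PQ(1,2)], fold h_def w_def)
    fix p q assume pq: "Re p > P" "Re q > Q"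
    then have pq0: "Re p > 0" "Re q > 0" using PQ by linarith+
    let ?z = "\<lambda>s. \<kappa> + of_nat s" and ?y = "\<lambda>r. \<rho> + \<Upsilon> * of_nat r"
    have zy: "Re (?z s) > 0" "Re (?y r) > 0" for s r
      using pos by (simp_all add: add_pos_nonneg)
    define \<phi> where "\<phi> s t = indicat_real {0<..} t *\<^sub>R (exp (- (p * of_real t)) * complex_of_real t powr (?z s - 1))" for s t
    define \<psi> where "\<psi> r t = indicat_real {0<..} t *\<^sub>R (exp (- (q * of_real t)) * complex_of_real t powr (?y r - 1))" for r t
    have \<phi>: "integrable lborel (\<phi> s)" "integral\<^sup>L lborel (\<phi> s) = Gamma (?z s) / p powr ?z s"
       "(LBINT t. norm (\<phi> s t)) = Gamma (Re \<kappa> + real s) / Re p powr (Re \<kappa> + real s)" for s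
      using set_integrable_exp_powr[OF zy(1) pq0(1)] laplace_powr[OF zy(1) pq0(1)] integral_norm_exp_powr[OF zy(1) pq0(1), of s]
      by (simp_all add: \<phi>_def[abs_def] set_integrable_def set_lebesgue_integral_def)
    have \<psi>: "integrable lborel (\<psi> r)" "integral\<^sup>L lborel (\<psi> r) = Gamma (?y r) / q powr ?y r"
       "(LBINT t. norm (\<psi> r t)) = Gamma (Re \<rho> + Re \<Upsilon> * real r) / Re q powr (Re \<rho> + Re \<Upsilon> * real r)" for r
      using set_integrable_exp_powr[OF zy(2) pq0(2)] laplace_powr[OF zy(2) pq0(2)] integral_norm_exp_powr[OF zy(2) pq0(2), of r]
      by (simp_all add: \<psi>_def[abs_def] set_integrable_def set_lebesgue_integral_def)
    define T where "T s r x = c s r * (\<phi> s (fst x) * \<psi> r (snd x))" for s r x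
    have Tint: "integrable lborel (T s r)" for s r
      unfolding T_def[abs_def] by (intro integrable_mult_right integrable_lborel_times \<phi> \<psi>)
    have Tval: "integral\<^sup>L lborel (T s r) = c s r * (Gamma (?z s) / p powr ?z s * (Gamma (?y r) / q powr ?y r))" for s r
      unfolding T_def[abs_def] by (simp add: integral_lborel_times[OF \<phi>(1) \<psi>(1)] \<phi> \<psi>)
    have Tnorm: "(LBINT x. norm (T s r x)) = norm (c s r) * (Gamma (Re \<kappa> + real s) / Re p powr (Re \<kappa> + real s)) *
      (Gamma (Re \<rho> + Re \<Upsilon> * real r) / Re q powr (Re \<rho> + Re \<Upsilon> * real r))" for s r
      using integral_lborel_times[OF integrable_norm[OF \<phi>(1)[of s]] integrable_norm[OF \<psi>(1)[of r]]]
      by (simp add: T_def norm_mult \<phi> \<psi>)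
    define C where "C = 2 ^ m * exp (pi * (1 + \<bar>Im \<kappa>\<bar> / d)) * exp (pi * (1 + \<bar>Im \<rho>\<bar> / e)) / (Re p powr Re \<kappa> * Re q powr Re \<rho>)"
    define a b where "a = P / Re p" and "b = Q0 / Re q powr Re \<Upsilon>"
    have bound: "(LBINT x. norm (T s r x)) \<le> C * a ^ s * b ^ r" for s r
      unfolding Tnorm C_def a_def b_def P_def Q0_def c_def
      by (rule integral_norm_hk_term_le[OF pos(3-5) d_def e_def m pq0])
    have "Q0 < Re q powr Re \<Upsilon>"
    proof (cases "Q0 = 0")
      case False
      have "Q0 = Q powr Re \<Upsilon>" using pos PQ False by (simp add: Q_def powr_powr)
      also have "\<dots> < Re q powr Re \<Upsilon>" using PQ pq pos by (intro powr_less_mono2) auto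
      finally show ?thesis .
    qed (use pq0 in simp)
    then have ab: "0 \<le> a" "a < 1" "0 \<le> b" "b < 1"
      using PQ pq pq0 by (auto simp: a_def b_def)
    note S = AE_summable_double[OF Tint bound ab] integrable_double_suminf[OF Tint bound ab] integral_double_suminf[OF Tint bound ab]
    let ?F = "\<lambda>x. indicat_real ({0<..} \<times> {0<..}) x *\<^sub>R (exp (- (p * of_real (fst x) + q * of_real (snd x))) * h (fst x) (snd x))"
    have AE: "AE x in lborel. (\<Sum>s. \<Sum>r. T s r x) = ?F x"
      using S(1)
    proof eventually_elim
      fix x :: "real \<times> real"
      assume sm: "(\<forall>s. summable (\<lambda>r. T s r x)) \<and> summable (\<lambda>s. \<Sum>r. T s r x)"
      obtain X Y where x: "x = (X, Y)" by (cases x)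
      show "(\<Sum>s. \<Sum>r. T s r x) = ?F x"
      proof (cases "X > 0 \<and> Y > 0")
        case False
        then show ?thesis by (auto simp: x T_def \<phi>_def \<psi>_def)
      next
        case True
        define t where "t s r = pochhammer \<gamma>1 (2 * s) * pochhammer \<gamma>2 (s + r) * (\<nu>1 * of_real X) ^ s * ((\<nu>2 * of_real Y) powr \<Upsilon>) ^ r /
         (pochhammer ((\<gamma>1 + 1) / 2) s * pochhammer \<gamma>2 s * Gamma (\<kappa> + of_nat s) *
          Gamma (\<rho> + \<Upsilon> * of_nat r) * fact r * fact s)" for s r
        define k where "k = exp (- (p * of_real X + q * of_real Y)) * (of_real X powr (\<kappa> - 1) * complex_of_real Y powr (\<rho> - 1))"
        \<comment> \<open>A nonzero factor transfers summability from \<open>T\<close> back to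
          \<open>t\<close>, as needed to pull \<open>k\<close> out of both sums.\<close>
        have k: "k \<noteq> 0" using True by (simp add: k_def)
        have Tt: "T s r x = k * t s r" for s r
        proof -
          have "T s r x = exp (- (p * of_real X)) * exp (- (q * of_real Y)) *
             (c s r * (of_real X powr (?z s - 1) * of_real Y powr (?y r - 1)))"
            using True by (simp add: T_def x \<phi>_def \<psi>_def mult_ac)
          also have "\<dots> = exp (- (p * of_real X)) * exp (- (q * of_real Y)) * (of_real X powr (\<kappa> - 1) * complex_of_real Y powr (\<rho> - 1) * t s r)"
            using hk_term_eq[OF pos(1,2), of X Y \<kappa> \<rho> s r \<nu>1 \<nu>2 \<Upsilon>] True by (simp only: t_def c_def w_def)
          also have "\<dots> = k * t s r" by (simp add: k_def exp_diff exp_minus field_simps)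
          finally show ?thesis .
        qed
        have "summable (\<lambda>r. t s r)" for s
          by (rule summable_mult_D[of k "t s"]) (use sm k in \<open>auto simp: Tt\<close>)
        then have inner: "(\<Sum>r. T s r x) = k * (\<Sum>r. t s r)" for s
          unfolding Tt by (rule suminf_mult)
        have "summable (\<lambda>s. \<Sum>r. t s r)"
          by (rule summable_mult_D[of k]) (use sm k in \<open>auto simp: inner\<close>)
        with inner have "(\<Sum>s. \<Sum>r. T s r x) = k * (\<Sum>s. \<Sum>r. t s r)"
          by (simp add: suminf_mult)
        also have "(\<Sum>s. \<Sum>r. t s r) =
            HK_mittag_leffler \<gamma>1 \<gamma>2 ((\<gamma>1 + 1) / 2) \<gamma>2 \<kappa> \<rho> \<Upsilon> (\<nu>1 * of_real X) (\<nu>2 * of_real Y)"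
          by (simp only: HK_mittag_leffler_def t_def)
        also have "k * \<dots> = ?F x"
          using True unfolding x k_def h_def hk_weighted_def by (simp add: mult_ac)
        finally show ?thesis .
      qed
    qed
    have meas: "(\<lambda>x. \<Sum>s. \<Sum>r. T s r x) \<in> borel_measurable lborel" using S(2) by simp
    have Fmeas: "?F \<in> borel_measurable lborel"
      unfolding h_def by (rule borel_measurable_hk_integrand)
    have Fint: "integrable lborel ?F"
      using S(2) integrable_cong_AE[OF meas Fmeas AE] by simp
    have "integral\<^sup>L lborel ?F = (\<integral>x. (\<Sum>s. \<Sum>r. T s r x) \<partial>lborel)"
      using integral_cong_AE[OF meas Fmeas AE] by simp
    with S(3) Fint show "double_laplace_exists h p q \<and> quadrant_laplace h p q =
       (\<Sum>s. \<Sum>r. hk_coeff \<gamma>1 \<gamma>2 \<kappa> \<rho> \<Upsilon> \<nu>1 w s r * (Gamma (?z s) / p powr ?z s * (Gamma (?y r) / q powr ?y r)))"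
      by (simp add: double_laplace_exists_iff quadrant_laplace_def set_integrable_def set_lebesgue_integral_def Tval c_def)
  qed
qed

text \<open>The \<open>Gamma\<close> factors cancel. The inner binomial series sums to
  \<open>(1 - v) powr (- \<gamma>2) / (1 - v) ^ s\<close>, and its \<open>s\<close>-th power joins
  \<open>(4 * \<nu>1 / p) ^ s\<close> to form the outer binomial series.\<close>

lemma hk_series_sum:
  fixes \<gamma>1 \<gamma>2 \<kappa> \<rho> \<Upsilon> \<nu>1 w p q :: complex
  assumes pos: "Re \<kappa> > 0" "Re \<rho> > 0" "Re \<Upsilon> > 0" and pq: "p \<noteq> 0" "q \<noteq> 0"
    and small: "norm (w / q powr \<Upsilon>) < 1" "norm (4 * \<nu>1 / (p * (1 - w / q powr \<Upsilon>))) < 1"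
  shows "(\<Sum>s. \<Sum>r. hk_coeff \<gamma>1 \<gamma>2 \<kappa> \<rho> \<Upsilon> \<nu>1 w s r *
           (Gamma (\<kappa> + of_nat s) / p powr (\<kappa> + of_nat s) *
            (Gamma (\<rho> + \<Upsilon> * of_nat r) / q powr (\<rho> + \<Upsilon> * of_nat r))))
    = 1 / (q powr \<rho> * p powr \<kappa>) * (1 - w / q powr \<Upsilon>) powr (- \<gamma>2) *
      (1 - 4 * \<nu>1 / (p * (1 - w / q powr \<Upsilon>))) powr (- (\<gamma>1 / 2))"
proof -
  define v where "v = w / q powr \<Upsilon>"
  have v: "1 - v \<noteq> 0" using small by (auto simp: v_def)
  have term_eq: "hk_coeff \<gamma>1 \<gamma>2 \<kappa> \<rho> \<Upsilon> \<nu>1 w s r *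
      (Gamma (\<kappa> + of_nat s) / p powr (\<kappa> + of_nat s) * (Gamma (\<rho> + \<Upsilon> * of_nat r) / q powr (\<rho> + \<Upsilon> * of_nat r)))
    = (1 / (q powr \<rho> * p powr \<kappa>) * (pochhammer (\<gamma>1 / 2) s / fact s * (4 * \<nu>1 / p) ^ s)) *
       (pochhammer (\<gamma>2 + of_nat s) r / fact r * v ^ r)" for s r
  proof -
    have "Gamma (\<kappa> + of_nat s) \<noteq> 0" "Gamma (\<rho> + \<Upsilon> * of_nat r) \<noteq> 0"
      using pos by (auto intro!: Gamma_ne_zero simp: add_pos_nonneg)
    moreover have "p powr (\<kappa> + of_nat s) = p powr \<kappa> * p ^ s"
      using powr_add_mult_of_nat[of p \<kappa> 1 s] pq by simp
    ultimately show ?thesis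
      by (simp add: hk_coeff_def v_def powr_add_mult_of_nat[OF pq(2)] power_divide power_mult_distrib mult_ac)
  qed
  have inner: "(\<Sum>r. pochhammer (\<gamma>2 + of_nat s) r / fact r * v ^ r) = (1 - v) powr (- \<gamma>2) / (1 - v) ^ s"
    and inner_summable: "summable (\<lambda>r. pochhammer (\<gamma>2 + of_nat s) r / fact r * v ^ r)" for s
  proof -
    have *: "(\<lambda>r. pochhammer (\<gamma>2 + of_nat s) r / fact r * v ^ r) sums (1 - v) powr (- (\<gamma>2 + of_nat s))"
      by (rule sums_pochhammer_power) (use small in \<open>simp add: v_def\<close>)
    have "(1 - v) powr (- (\<gamma>2 + of_nat s)) = (1 - v) powr (- \<gamma>2) / (1 - v) ^ s"
      using powr_add_mult_of_nat[OF v, of "- \<gamma>2" "- 1" s] v by (simp add: powr_minus power_inverse divide_inverse)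
    with * show "(\<Sum>r. pochhammer (\<gamma>2 + of_nat s) r / fact r * v ^ r) = (1 - v) powr (- \<gamma>2) / (1 - v) ^ s"
      "summable (\<lambda>r. pochhammer (\<gamma>2 + of_nat s) r / fact r * v ^ r)"
      by (simp_all add: sums_iff)
  qed
  let ?K = "1 / (q powr \<rho> * p powr \<kappa>) * (1 - v) powr (- \<gamma>2)"
  have "(\<Sum>r. hk_coeff \<gamma>1 \<gamma>2 \<kappa> \<rho> \<Upsilon> \<nu>1 w s r *
      (Gamma (\<kappa> + of_nat s) / p powr (\<kappa> + of_nat s) * (Gamma (\<rho> + \<Upsilon> * of_nat r) / q powr (\<rho> + \<Upsilon> * of_nat r))))
    = ?K * (pochhammer (\<gamma>1 / 2) s / fact s * (4 * \<nu>1 / (p * (1 - v))) ^ s)" for s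
    unfolding term_eq
    unfolding suminf_mult[OF inner_summable] inner by (simp add: power_divide power_mult_distrib mult_ac)
  moreover have "(\<lambda>s. ?K * (pochhammer (\<gamma>1 / 2) s / fact s * (4 * \<nu>1 / (p * (1 - v))) ^ s)) sums
      (?K * (1 - 4 * \<nu>1 / (p * (1 - v))) powr (- (\<gamma>1 / 2)))"
    using small by (intro sums_mult sums_pochhammer_power) (simp add: v_def)
  ultimately show ?thesis by (simp add: sums_iff v_def)
qed

subsection \<open>Continuation to every point of absolute convergence\<close>

lemma laplace_shift_analytic:
  fixes g :: "'a \<Rightarrow> complex"
  assumes g: "integrable M g" and u: "u \<in> borel_measurable M" "AE x in M. 0 \<le> (u x :: real)"
  shows "(\<lambda>z. \<integral>x. exp (- ((z - a) * of_real (u x))) * g x \<partial>M) analytic_on {z. Re z > Re a}"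
proof -
  have "((\<lambda>z. \<integral>x. exp (- (z * of_real (u x))) * g x \<partial>M) \<circ> (\<lambda>z. z - a)) analytic_on {z. Re z > Re a}"
    by (rule analytic_on_compose_gen[OF _ laplace_analytic[OF g u]]) (auto intro!: analytic_intros)
  then show ?thesis by (simp add: o_def)
qed

text \<open>With the indicator included, a change of \<open>p\<close> or \<open>q\<close> is
  multiplication by an exponential weight on the whole plane, the setting of the general Laplace
  lemmas.\<close>

definition quadrant_integrand :: "(real \<Rightarrow> real \<Rightarrow> complex) \<Rightarrow> complex \<Rightarrow> complex \<Rightarrow> real \<times> real \<Rightarrow> complex" where
  "quadrant_integrand h p q x = indicat_real ({0<..} \<times> {0<..}) x *\<^sub>R
     (exp (- (p * of_real (fst x) + q * of_real (snd x))) * h (fst x) (snd x))"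

lemma double_laplace_exists_iff_integrable:
  "double_laplace_exists h p q \<longleftrightarrow> integrable lborel (quadrant_integrand h p q)"
  by (simp add: double_laplace_exists_iff set_integrable_def quadrant_integrand_def[abs_def])

lemma quadrant_laplace_eq_integral:
  "quadrant_laplace h p q = (LBINT x. quadrant_integrand h p q x)"
  by (simp add: quadrant_laplace_def set_lebesgue_integral_def quadrant_integrand_def)

lemma borel_measurable_max_fst_snd [measurable]:
  "(\<lambda>x. max 0 (fst x)) \<in> borel_measurable (lborel :: (real \<times> real) measure)"
  "(\<lambda>x. max 0 (snd x)) \<in> borel_measurable (lborel :: (real \<times> real) measure)"
  unfolding lborel_prod[symmetric] by measurable

lemma
  shows quadrant_integrand_shift_fst: "quadrant_integrand h p' q x = exp (- ((p' - p) * of_real (max 0 (fst x)))) * quadrant_integrand h p q x"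
    and quadrant_integrand_shift_snd: "quadrant_integrand h p q' x = exp (- ((q' - q) * of_real (max 0 (snd x)))) * quadrant_integrand h p q x"
proof -
  have "exp (- (p' * of_real X + q * of_real Y)) = exp (- ((p' - p) * of_real X)) * exp (- (p * of_real X + q * of_real Y))"
    "exp (- (p * of_real X + q' * of_real Y)) = exp (- ((q' - q) * of_real Y)) * exp (- (p * of_real X + q * of_real Y))" for X Y
    unfolding exp_add[symmetric] by (simp_all add: algebra_simps)
  then show "quadrant_integrand h p' q x = exp (- ((p' - p) * of_real (max 0 (fst x)))) * quadrant_integrand h p q x"
    "quadrant_integrand h p q' x = exp (- ((q' - q) * of_real (max 0 (snd x)))) * quadrant_integrand h p q x"
    by (auto simp: quadrant_integrand_def indicator_def)
qed

lemma
  shows quadrant_laplace_shift_fst: "quadrant_laplace h p' q =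
      (LBINT x. exp (- ((p' - p) * of_real (max 0 (fst x)))) * quadrant_integrand h p q x)"
    and quadrant_laplace_shift_snd: "quadrant_laplace h p q' =
      (LBINT x. exp (- ((q' - q) * of_real (max 0 (snd x)))) * quadrant_integrand h p q x)"
  unfolding quadrant_laplace_eq_integral
  by (intro Bochner_Integration.integral_cong refl quadrant_integrand_shift_fst quadrant_integrand_shift_snd)+

lemma double_laplace_exists_shift_fst:
  assumes "double_laplace_exists h p q" "Re p \<le> Re p'"
  shows "double_laplace_exists h p' q"
  using integrable_laplace[OF assms(1)[unfolded double_laplace_exists_iff_integrable]
      borel_measurable_max_fst_snd(1), of "p' - p"] assms(2)
  unfolding double_laplace_exists_iff_integrable
  by (simp add: quadrant_integrand_shift_fst[symmetric])

lemma
  assumes "double_laplace_exists h p q"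
  shows quadrant_laplace_analytic_fst: "(\<lambda>z. quadrant_laplace h z q) analytic_on {z. Re z > Re p}"
    and quadrant_laplace_analytic_snd: "(\<lambda>z. quadrant_laplace h p z) analytic_on {z. Re z > Re q}"
proof -
  note int = assms[unfolded double_laplace_exists_iff_integrable]
  show "(\<lambda>z. quadrant_laplace h z q) analytic_on {z. Re z > Re p}"
    unfolding quadrant_laplace_shift_fst[where p = p]
    by (rule laplace_shift_analytic[OF int]) auto
  show "(\<lambda>z. quadrant_laplace h p z) analytic_on {z. Re z > Re q}"
    unfolding quadrant_laplace_shift_snd[where q = q]
    by (rule laplace_shift_analytic[OF int]) auto
qed

lemma
  assumes "double_laplace_exists h p q"
  shows quadrant_laplace_tendsto_fst:
      "(\<And>n. Re p \<le> Re (z n)) \<Longrightarrow> z \<longlonglongrightarrow> p \<Longrightarrow> (\<lambda>n. quadrant_laplace h (z n) q) \<longlonglongrightarrow> quadrant_laplace h p q"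
    and quadrant_laplace_tendsto_snd:
      "(\<And>n. Re q \<le> Re (z n)) \<Longrightarrow> z \<longlonglongrightarrow> q \<Longrightarrow> (\<lambda>n. quadrant_laplace h p (z n)) \<longlonglongrightarrow> quadrant_laplace h p q"
proof -
  note int = assms[unfolded double_laplace_exists_iff_integrable]
  show "(\<lambda>n. quadrant_laplace h (z n) q) \<longlonglongrightarrow> quadrant_laplace h p q"
    if "\<And>n. Re p \<le> Re (z n)" "z \<longlonglongrightarrow> p"
    using laplace_tendsto[OF int borel_measurable_max_fst_snd(1), of "\<lambda>n. z n - p" 0] that
    unfolding quadrant_laplace_shift_fst[where p = p]
    by (simp add: LIM_zero)
  show "(\<lambda>n. quadrant_laplace h p (z n)) \<longlonglongrightarrow> quadrant_laplace h p q"
    if "\<And>n. Re q \<le> Re (z n)" "z \<longlonglongrightarrow> q"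
    using laplace_tendsto[OF int borel_measurable_max_fst_snd(2), of "\<lambda>n. z n - q" 0] that
    unfolding quadrant_laplace_shift_snd[where q = q]
    by (simp add: LIM_zero)
qed

text \<open>A bound independent of \<open>p'\<close>; it later excludes a blow-up of the closed
  form.\<close>

lemma norm_quadrant_laplace_le:
  assumes "double_laplace_exists h p q" "Re p \<le> Re p'"
  shows "norm (quadrant_laplace h p' q) \<le> (LBINT x. norm (quadrant_integrand h p q x))"
proof -
  have "norm (quadrant_laplace h p' q) \<le> (LBINT x. norm (quadrant_integrand h p' q x))"
    unfolding quadrant_laplace_eq_integral by (rule integral_norm_bound)
  also have "\<dots> \<le> (LBINT x. norm (quadrant_integrand h p q x))"
  proof (rule integral_mono)
    show "integrable lborel (\<lambda>x. norm (quadrant_integrand h p' q x))" "integrable lborel (\<lambda>x. norm (quadrant_integrand h p q x))"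
      using double_laplace_exists_shift_fst[OF assms] assms(1)
      unfolding double_laplace_exists_iff_integrable by auto
    show "norm (quadrant_integrand h p' q x) \<le> norm (quadrant_integrand h p q x)" for x
      unfolding quadrant_integrand_shift_fst[where p' = p' and p = p]
      by (rule norm_exp_mult_le) (use assms(2) in auto)
  qed
  finally show ?thesis .
qed

section \<open>The closed form along rays\<close>

lemma ray_tendsto: "(\<lambda>n. complex_of_real (1 + 1 / real (Suc n)) * a) \<longlonglongrightarrow> a"
proof -
  have "(\<lambda>n. 1 + 1 / real (Suc n)) \<longlonglongrightarrow> 1 + 0" by (intro tendsto_intros LIMSEQ_Suc[OF lim_1_over_n])
  then have "(\<lambda>n. complex_of_real (1 + 1 / real (Suc n)) * a) \<longlonglongrightarrow> of_real (1 + 0) * a"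
    by (intro tendsto_mult tendsto_of_real tendsto_const)
  then show ?thesis by simp
qed

text \<open>At the endpoint \<open>f\<close> has only a limit along the ray, being possibly on the
  boundary of its domain of convergence, whereas \<open>G\<close> is analytic there.\<close>

lemma analytic_continuation_ray_endpoint:
  fixes f G :: "complex \<Rightarrow> complex"
  assumes f: "f analytic_on (of_real ` {1<..})" and G: "G analytic_on (of_real ` {1..})"
    and eq: "\<And>t. t > T \<Longrightarrow> f (of_real t) = G (of_real t)"
    and lim: "(\<lambda>n. f (of_real (1 + 1 / real (Suc n)))) \<longlonglongrightarrow> f 1"
  shows "f 1 = G 1"
proof (rule LIMSEQ_unique[OF lim])
  let ?t = "\<lambda>n. 1 + 1 / real (Suc n)"
  have G1: "G analytic_on (of_real ` {1<..})" by (rule analytic_on_subset[OF G image_mono]) auto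
  have "f (of_real (?t n)) = G (of_real (?t n))" for n
    by (rule analytic_continuation_ray[OF f G1 eq]) auto
  moreover have "isCont G 1"
    by (rule analytic_at_imp_isCont, rule analytic_on_subset[OF G]) (auto intro!: image_eqI[of _ _ 1])
  then have "(\<lambda>n. G (of_real (?t n))) \<longlonglongrightarrow> G 1"
    by (rule isCont_tendsto_compose) (use ray_tendsto[of 1] in simp)
  ultimately show "(\<lambda>n. f (of_real (?t n))) \<longlonglongrightarrow> G 1" by simp
qed

definition hk_closed :: "complex \<Rightarrow> complex \<Rightarrow> complex \<Rightarrow> complex \<Rightarrow> complex \<Rightarrow> complex \<Rightarrow> complex \<Rightarrow> complex \<Rightarrow> complex \<Rightarrow> complex" where
  "hk_closed \<gamma>1 \<gamma>2 \<kappa> \<rho> \<Upsilon> \<nu>1 w p q =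
     1 / (q powr \<rho> * p powr \<kappa>) * (1 - w / q powr \<Upsilon>) powr (- \<gamma>2) *
      (1 - 4 * \<nu>1 / (p * (1 - w / q powr \<Upsilon>))) powr (- (\<gamma>1 / 2))"

lemma one_minus_notin_nonpos_Reals: "norm z < 1 \<Longrightarrow> 1 - z \<notin> \<real>\<^sub>\<le>\<^sub>0" for z :: complex
  using complex_Re_le_cmod[of z] by (auto simp: complex_nonpos_Reals_iff)

lemma mult_of_real_notin_nonpos_Reals: "Re q > 0 \<Longrightarrow> t > 0 \<Longrightarrow> of_real t * q \<notin> \<real>\<^sub>\<le>\<^sub>0"
  by (auto simp: complex_nonpos_Reals_iff mult_le_0_iff)

lemma div_by_one_le: "0 \<le> x \<Longrightarrow> 1 \<le> y \<Longrightarrow> x / y \<le> x" for x y :: real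
  using mult_left_mono[of 1 y x] by (simp add: pos_divide_le_eq)

text \<open>Moving \<open>q\<close> outwards divides the norm by
  \<open>t powr Re \<Upsilon> \<ge> 1\<close>, so smallness at \<open>q\<close> persists along the
  ray.\<close>

lemma norm_div_scaled_powr_le:
  assumes "t \<ge> 1" "Re \<Upsilon> > 0"
  shows "norm (w / (of_real t * q) powr \<Upsilon>) \<le> norm (w / q powr \<Upsilon>)"
proof -
  have "norm ((of_real t * q) powr \<Upsilon>) = t powr Re \<Upsilon> * norm (q powr \<Upsilon>)"
    using assms by (simp add: powr_times_real_left norm_mult norm_powr_real_powr)
  moreover have "1 \<le> t powr Re \<Upsilon>" using assms by (simp add: ge_one_powr_ge_zero)
  ultimately have "norm (w / (of_real t * q) powr \<Upsilon>) = norm (w / q powr \<Upsilon>) / t powr Re \<Upsilon>"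
    by (simp add: norm_divide)
  also have "\<dots> \<le> norm (w / q powr \<Upsilon>)"
    using \<open>1 \<le> t powr Re \<Upsilon>\<close> by (intro div_by_one_le) simp_all
  finally show ?thesis .
qed

lemma norm_div_one_minus_lt_one:
  fixes c v :: complex
  assumes "norm c < 1 - norm v'" "norm v \<le> norm v'"
  shows "norm (c / (1 - v)) < 1"
proof -
  have "norm c < norm (1 - v)" using norm_triangle_ineq2[of 1 v] assms by simp
  moreover from this have "0 < norm (1 - v)" using norm_ge_zero[of c] by linarith
  ultimately show ?thesis by (simp add: norm_divide)
qed

text \<open>Both bases of the outer powers stay in the open unit disc around 1, away from the cut.
  The assumption on \<open>4 * \<nu>1 / p\<close> is met by taking the first variable large.\<close>

lemma hk_closed_analytic_snd:
  assumes q: "Re q > 0" and U: "Re \<Upsilon> > 0" and v: "norm (w / q powr \<Upsilon>) < 1" and p: "p \<noteq> 0"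
    and c: "norm (4 * \<nu>1 / p) < 1 - norm (w / q powr \<Upsilon>)"
  shows "(\<lambda>z. hk_closed \<gamma>1 \<gamma>2 \<kappa> \<rho> \<Upsilon> \<nu>1 w p (z * q)) analytic_on (of_real ` {1..})"
proof -
  have 1: "of_real t * q \<notin> \<real>\<^sub>\<le>\<^sub>0" "(of_real t * q) \<noteq> 0" "1 - w / (of_real t * q) powr \<Upsilon> \<notin> \<real>\<^sub>\<le>\<^sub>0"
     "1 - w / (of_real t * q) powr \<Upsilon> \<noteq> 0"
     "1 - 4 * \<nu>1 / (p * (1 - w / (of_real t * q) powr \<Upsilon>)) \<notin> \<real>\<^sub>\<le>\<^sub>0" if t: "t \<ge> 1" for t
  proof -
    note le = norm_div_scaled_powr_le[OF t U, of w q]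
    show *: "of_real t * q \<notin> \<real>\<^sub>\<le>\<^sub>0" using q t by (intro mult_of_real_notin_nonpos_Reals) auto
    then show "of_real t * q \<noteq> 0" by auto
    show *: "1 - w / (of_real t * q) powr \<Upsilon> \<notin> \<real>\<^sub>\<le>\<^sub>0"
      using le v by (intro one_minus_notin_nonpos_Reals) linarith
    then show "1 - w / (of_real t * q) powr \<Upsilon> \<noteq> 0" by auto
    have "norm (4 * \<nu>1 / p / (1 - w / (of_real t * q) powr \<Upsilon>)) < 1"
      using norm_div_one_minus_lt_one[OF c le] .
    then show "1 - 4 * \<nu>1 / (p * (1 - w / (of_real t * q) powr \<Upsilon>)) \<notin> \<real>\<^sub>\<le>\<^sub>0"
      using one_minus_notin_nonpos_Reals by simp
  qed
  show ?thesis
    unfolding hk_closed_def using p 1 by (intro analytic_intros) auto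
qed

lemma hk_closed_analytic_fst:
  assumes p: "Re p > 0"
    and c: "\<And>t. t \<in> A \<Longrightarrow> t > 0" "\<And>t. t \<in> A \<Longrightarrow> 1 - 4 * \<nu>1 / (of_real t * p * (1 - w / q powr \<Upsilon>)) \<notin> \<real>\<^sub>\<le>\<^sub>0"
    and q: "q \<noteq> 0" "1 - w / q powr \<Upsilon> \<noteq> 0"
  shows "(\<lambda>z. hk_closed \<gamma>1 \<gamma>2 \<kappa> \<rho> \<Upsilon> \<nu>1 w (z * p) q) analytic_on (of_real ` A)"
proof -
  have "of_real t * p \<notin> \<real>\<^sub>\<le>\<^sub>0" "of_real t * p \<noteq> 0" if "t \<in> A" for t
    using mult_of_real_notin_nonpos_Reals[OF p c(1)[OF that]] by auto
  then show ?thesis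
    unfolding hk_closed_def using p c q by (intro analytic_intros) auto
qed

lemma ray_analytic:
  assumes "f analytic_on {z. Re z > Re a}" "Re a > 0" "1 \<le> t0"
  shows "(\<lambda>z. f (z * a)) analytic_on (of_real ` {t0<..})"
proof -
  have "(f \<circ> (\<lambda>z. z * a)) analytic_on (of_real ` {t0<..})"
    by (rule analytic_on_compose_gen[OF _ assms(1)]) (use assms in \<open>auto intro!: analytic_intros\<close>)
  then show ?thesis by (simp add: o_def)
qed

lemma quadrant_laplace_eq_hk_closed_large:
  fixes \<gamma>1 \<gamma>2 \<kappa> \<rho> \<Upsilon> \<nu>1 \<nu>2 p q :: complex
  assumes pos: "Re \<gamma>1 > 0" "Re \<gamma>2 > 0" "Re \<kappa> > 0" "Re \<rho> > 0" "Re \<Upsilon> > 0"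
    and pq: "Re p > 0" "Re q > 0" and v: "norm (\<nu>2 powr \<Upsilon> / q powr \<Upsilon>) < 1"
    and ex: "double_laplace_exists (hk_weighted \<gamma>1 \<gamma>2 \<kappa> \<rho> \<Upsilon> \<nu>1 \<nu>2) p q"
  obtains S where "1 \<le> S" "\<And>t. t > S \<Longrightarrow>
    quadrant_laplace (hk_weighted \<gamma>1 \<gamma>2 \<kappa> \<rho> \<Upsilon> \<nu>1 \<nu>2) (of_real t * p) q =
      hk_closed \<gamma>1 \<gamma>2 \<kappa> \<rho> \<Upsilon> \<nu>1 (\<nu>2 powr \<Upsilon>) (of_real t * p) q"
proof -
  define w where "w = \<nu>2 powr \<Upsilon>"
  define h where "h = hk_weighted \<gamma>1 \<gamma>2 \<kappa> \<rho> \<Upsilon> \<nu>1 \<nu>2"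
  obtain P Q where PQ: "0 \<le> P" "0 \<le> Q"
    and series: "\<And>p q. Re p > P \<Longrightarrow> Re q > Q \<Longrightarrow> quadrant_laplace h p q =
        (\<Sum>s. \<Sum>r. hk_coeff \<gamma>1 \<gamma>2 \<kappa> \<rho> \<Upsilon> \<nu>1 w s r *
           (Gamma (\<kappa> + of_nat s) / p powr (\<kappa> + of_nat s) *
            (Gamma (\<rho> + \<Upsilon> * of_nat r) / q powr (\<rho> + \<Upsilon> * of_nat r))))"
    by (rule hk_double_series[OF pos, of \<nu>1 \<nu>2, folded h_def w_def]) blast
  define \<delta> where "\<delta> = 1 - norm (w / q powr \<Upsilon>)"
  have \<delta>: "\<delta> > 0" using v by (simp add: \<delta>_def w_def)
  \<comment> \<open>The second entry carries \<open>t * p\<close> into the range of the double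
    series, the third makes \<open>norm (4 * \<nu>1 / (t * p)) < \<delta>\<close>.\<close>
  define S where "S = max 1 (max (P / Re p) (norm (4 * \<nu>1 / p) / \<delta>))"
  show thesis
  proof (rule that[of S, folded h_def w_def])
    show "1 \<le> S" by (simp add: S_def)
    fix t assume "t > S"
    then have t: "t > 1" "P < Re (of_real t * p)" "norm (4 * \<nu>1 / p) < \<delta> * t"
      using pq \<delta> by (simp_all add: S_def field_simps)
    define p1 where "p1 = of_real t * p"
    have p1: "Re p1 > 0" "p1 \<noteq> 0" "Re p \<le> Re p1" using pq t by (auto simp: p1_def mult_le_cancel_right1)
    have small: "norm (4 * \<nu>1 / p1) < 1 - norm (w / q powr \<Upsilon>)"
    proof -
      have "norm (4 * \<nu>1 / p1) = norm (4 * \<nu>1 / p) / t" using t by (simp add: p1_def norm_mult norm_divide)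
      also have "\<dots> < \<delta>" using t by (simp add: pos_divide_less_eq)
      finally show ?thesis by (simp add: \<delta>_def)
    qed
    have ex1: "double_laplace_exists h p1 q"
      using double_laplace_exists_shift_fst[OF ex p1(3)] by (simp add: h_def)
    have eq: "quadrant_laplace h p1 (of_real T * q) = hk_closed \<gamma>1 \<gamma>2 \<kappa> \<rho> \<Upsilon> \<nu>1 w p1 (of_real T * q)"
      if "T > max 1 (Q / Re q)" for T
    proof -
      have T: "T \<ge> 1" "Re (of_real T * q) > Q" using that pq by (simp_all add: field_simps)
      note le = norm_div_scaled_powr_le[OF T(1) pos(5), of w q]
      have "norm (4 * \<nu>1 / p1 / (1 - w / (of_real T * q) powr \<Upsilon>)) < 1"
        using norm_div_one_minus_lt_one[OF small le] .
      then have s2: "norm (4 * \<nu>1 / (p1 * (1 - w / (of_real T * q) powr \<Upsilon>))) < 1" by simp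
      have s1: "norm (w / (of_real T * q) powr \<Upsilon>) < 1" using le v by (simp add: w_def)
      have "of_real T * q \<noteq> 0" using pq T by auto
      then show ?thesis
        using series[of p1 "of_real T * q"] T t hk_series_sum[OF pos(3-5) p1(2) _ s1 s2]
        by (simp add: hk_closed_def p1_def)
    qed
    have "quadrant_laplace h p1 (1 * q) = hk_closed \<gamma>1 \<gamma>2 \<kappa> \<rho> \<Upsilon> \<nu>1 w p1 (1 * q)"
    proof (rule analytic_continuation_ray_endpoint[where f = "\<lambda>z. quadrant_laplace h p1 (z * q)" and G = "\<lambda>z. hk_closed \<gamma>1 \<gamma>2 \<kappa> \<rho> \<Upsilon> \<nu>1 w p1 (z * q)"])
      show "(\<lambda>z. quadrant_laplace h p1 (z * q)) analytic_on (of_real ` {1<..})"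
        by (rule ray_analytic[OF quadrant_laplace_analytic_snd[OF ex1] pq(2)]) simp
      show "(\<lambda>z. hk_closed \<gamma>1 \<gamma>2 \<kappa> \<rho> \<Upsilon> \<nu>1 w p1 (z * q)) analytic_on (of_real ` {1..})"
        by (rule hk_closed_analytic_snd[OF pq(2) pos(5) _ p1(2) small]) (use v in \<open>simp add: w_def\<close>)
      show "(\<lambda>n. quadrant_laplace h p1 (of_real (1 + 1 / real (Suc n)) * q)) \<longlonglongrightarrow> quadrant_laplace h p1 (1 * q)"
        using quadrant_laplace_tendsto_snd[OF ex1 _ ray_tendsto] pq
        by (simp add: distrib_right)
    qed (rule eq)
    then show "quadrant_laplace h (of_real t * p) q = hk_closed \<gamma>1 \<gamma>2 \<kappa> \<rho> \<Upsilon> \<nu>1 w (of_real t * p) q"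
      by (simp add: p1_def)
  qed
qed

text \<open>Continuation in the first variable, from large \<open>t * p\<close> down to
  \<open>p\<close>. Existence of the transform at \<open>(p, q)\<close> is what rules out the branch
  cut.\<close>

lemma quadrant_laplace_eq_hk_closed:
  fixes \<gamma>1 \<gamma>2 \<kappa> \<rho> \<Upsilon> \<nu>1 \<nu>2 p q :: complex
  assumes pos: "Re \<gamma>1 > 0" "Re \<gamma>2 > 0" "Re \<kappa> > 0" "Re \<rho> > 0" "Re \<Upsilon> > 0"
    and pq: "Re p > 0" "Re q > 0" and v: "norm (\<nu>2 powr \<Upsilon> / q powr \<Upsilon>) < 1"
    and ex: "double_laplace_exists (hk_weighted \<gamma>1 \<gamma>2 \<kappa> \<rho> \<Upsilon> \<nu>1 \<nu>2) p q"
  shows "quadrant_laplace (hk_weighted \<gamma>1 \<gamma>2 \<kappa> \<rho> \<Upsilon> \<nu>1 \<nu>2) p q =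
      hk_closed \<gamma>1 \<gamma>2 \<kappa> \<rho> \<Upsilon> \<nu>1 (\<nu>2 powr \<Upsilon>) p q"
proof -
  define w where "w = \<nu>2 powr \<Upsilon>"
  define h where "h = hk_weighted \<gamma>1 \<gamma>2 \<kappa> \<rho> \<Upsilon> \<nu>1 \<nu>2"
  note ex = ex[folded h_def]
  let ?f = "\<lambda>z. quadrant_laplace h (z * p) q" and ?G = "\<lambda>z. hk_closed \<gamma>1 \<gamma>2 \<kappa> \<rho> \<Upsilon> \<nu>1 w (z * p) q"
  obtain S where S: "1 \<le> S" "\<And>t. t > S \<Longrightarrow> ?f (of_real t) = ?G (of_real t)"
    using quadrant_laplace_eq_hk_closed_large[OF pos pq v ex[unfolded h_def]] unfolding h_def w_def by blast
  have pq0: "p \<noteq> 0" "q \<noteq> 0" using pq by auto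
  define V where "V = 1 - w / q powr \<Upsilon>"
  have V: "V \<noteq> 0" using v by (auto simp: V_def w_def)
  define c where "c = 4 * \<nu>1 / (p * V)"
  have c: "4 * \<nu>1 / (of_real t * p * V) = c / of_real t" for t by (simp add: c_def)
  have f_analytic: "?f analytic_on (of_real ` {t0<..})" if "1 \<le> t0" for t0
    by (rule ray_analytic[OF quadrant_laplace_analytic_fst[OF ex] pq(1) that])
  \<comment> \<open>A value \<open>y \<le> 0\<close> on the cut would force
    \<open>c = t * (1 - y)\<close>, real and at least \<open>t\<close>.\<close>
  have notin: "1 - c / of_real t \<notin> \<real>\<^sub>\<le>\<^sub>0" if "t > 0" "\<not> (\<exists>c0. c = of_real c0 \<and> c0 \<ge> t)" for t
  proof
    assume "1 - c / of_real t \<in> \<real>\<^sub>\<le>\<^sub>0"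
    then obtain y where y: "1 - c / of_real t = of_real y" "y \<le> 0" by (elim nonpos_Reals_cases)
    then have "c = of_real (t * (1 - y))" using that(1) by (simp add: field_simps)
    moreover have "t * (1 - y) \<ge> t" using y that by (simp add: mult_le_cancel_left1)
    ultimately show False using that(2) by blast
  qed
  have G_analytic: "?G analytic_on (of_real ` A)"
    if "\<And>t. t \<in> A \<Longrightarrow> t > 0" "\<And>t. t \<in> A \<Longrightarrow> 1 - c / of_real t \<notin> \<real>\<^sub>\<le>\<^sub>0" for A
    using that V pq0 by (intro hk_closed_analytic_fst pq(1)) (auto simp: c V_def[symmetric])
  show ?thesis
  proof (cases "\<exists>c0. c = of_real c0 \<and> c0 \<ge> 1")
    case False
    have "?f 1 = ?G 1"
    proof (rule analytic_continuation_ray_endpoint[OF f_analytic _ S(2)])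
      show "?G analytic_on (of_real ` {1..})"
        by (intro G_analytic notin) (use False in \<open>auto intro: order_trans\<close>)
      show "(\<lambda>n. quadrant_laplace h (of_real (1 + 1 / real (Suc n)) * p) q) \<longlonglongrightarrow> quadrant_laplace h (1 * p) q"
        using quadrant_laplace_tendsto_fst[OF ex _ ray_tendsto] pq
        by (simp add: distrib_right)
    qed auto
    then show ?thesis by (simp add: h_def w_def)
  next
    case True
    then obtain c0 where c0: "c = of_real c0" "1 \<le> c0" by blast
    \<comment> \<open>The closed form is reached only for \<open>t > c0\<close>, as the ray hits the
      cut at \<open>t = c0\<close>; this is enough for a contradiction.\<close>
    have eq: "?f (of_real t) = ?G (of_real t)" if "t > c0" for t
    proof (rule analytic_continuation_ray[OF f_analytic[OF c0(2)] _ S(2) that])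
      show "?G analytic_on (of_real ` {c0<..})"
        using c0 by (intro G_analytic notin) auto
    qed
    define B where "B = (LBINT x. norm (quadrant_integrand h p q x))"
    define A where "A t = 1 / (q powr \<rho> * (of_real t * p) powr \<kappa>) * V powr (- \<gamma>2)" for t
    define t where "t n = c0 * (1 + 1 / real (Suc n))" for n
    have t: "t n > c0" for n using c0 by (simp add: t_def distrib_left)
    have tlim: "t \<longlonglongrightarrow> c0"
    proof -
      have "t \<longlonglongrightarrow> c0 * (1 + 0)" unfolding t_def[abs_def]
        by (intro tendsto_intros LIMSEQ_Suc[OF lim_1_over_n])
      then show ?thesis by simp
    qed
    \<comment> \<open>\<open>A\<close> collects the factors that stay regular at \<open>c0\<close>.
      Since the transform is bounded by \<open>B\<close>, the inverse of the singular factor moves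
      to the right, where it tends to 0 because \<open>Re \<gamma>1 > 0\<close>.\<close>
    have bound: "norm (A (t n)) \<le> B * (1 - c0 / t n) powr (Re \<gamma>1 / 2)" for n
    proof -
      have pos_t: "1 - c0 / t n > 0" "t n > 1" "t n \<ge> 1" using t[of n] c0 by (auto simp: field_simps)
      have "norm (?f (of_real (t n))) \<le> B"
        unfolding B_def using pos_t pq
        by (intro norm_quadrant_laplace_le[OF ex]) (simp add: mult_le_cancel_right1)
      then have "norm (A (t n) * (1 - of_real c0 / of_real (t n)) powr (- (\<gamma>1 / 2))) \<le> B"
        unfolding eq[OF t] hk_closed_def V_def[symmetric] c c0(1) A_def by simp
      moreover have "norm ((1 - complex_of_real c0 / of_real (t n)) powr (- (\<gamma>1 / 2))) = (1 - c0 / t n) powr (- (Re \<gamma>1 / 2))"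
      proof -
        have "1 - complex_of_real c0 / of_real (t n) = of_real (1 - c0 / t n)" by simp
        then show ?thesis using pos_t(1) by (simp only:) (simp add: norm_powr_real_powr del: of_real_diff of_real_divide)
      qed
      ultimately have "norm (A (t n)) * (1 - c0 / t n) powr (- (Re \<gamma>1 / 2)) \<le> B" by (simp add: norm_mult)
      then have "norm (A (t n)) * (1 - c0 / t n) powr (- (Re \<gamma>1 / 2)) * (1 - c0 / t n) powr (Re \<gamma>1 / 2) \<le> B * (1 - c0 / t n) powr (Re \<gamma>1 / 2)"
        by (rule mult_right_mono) simp
      moreover have "y powr (- x) * y powr x = 1" if "y > 0" for x y :: real
        using that by (simp add: powr_minus)
      note this[OF pos_t(1), of "Re \<gamma>1 / 2"]
      ultimately show ?thesis by (simp only: mult.assoc mult_1_right)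
    qed
    have "(\<lambda>n. (1 - c0 / t n) powr (Re \<gamma>1 / 2)) \<longlonglongrightarrow> 0"
    proof (rule tendsto_zero_powrI[OF _ tendsto_const])
      have "(\<lambda>n. 1 - c0 / t n) \<longlonglongrightarrow> 1 - c0 / c0" using c0 by (intro tendsto_intros tlim) auto
      then show "(\<lambda>n. 1 - c0 / t n) \<longlonglongrightarrow> 0" using c0 by simp
      have "c0 / t n \<le> 1" for n using t[of n] c0 by simp
      then show "\<forall>\<^sub>F n in sequentially. 0 \<le> 1 - c0 / t n" by simp
    qed (use pos in simp)
    then have "(\<lambda>n. B * (1 - c0 / t n) powr (Re \<gamma>1 / 2)) \<longlonglongrightarrow> B * 0" by (intro tendsto_intros)
    moreover have "(\<lambda>n. norm (A (t n))) \<longlonglongrightarrow> norm (A c0)"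
    proof -
      have "of_real c0 * p \<notin> \<real>\<^sub>\<le>\<^sub>0" using c0 pq by (intro mult_of_real_notin_nonpos_Reals) auto
      then show ?thesis
        unfolding A_def using pq0 c0 by (intro tendsto_intros tendsto_powr_complex tlim) auto
    qed
    ultimately have "norm (A c0) \<le> B * 0" using bound by (intro LIMSEQ_le) auto
    \<comment> \<open>The bound forces \<open>A c0 = 0\<close>, yet \<open>A c0\<close> is a product
      of nonzero powers.\<close>
    moreover have "A c0 \<noteq> 0" using pq0 V c0 by (simp add: A_def)
    ultimately show ?thesis by simp
  qed
qed

text \<open>The value is asserted under \<open>double_laplace_exists\<close> to guard against the
  default value 0 of a divergent integral; the first conjunct shows that convergence does
  occur.\<close>

theorem theorem14:
  fixes \<gamma>1 \<gamma>2 \<kappa> \<rho> \<Upsilon> \<nu>1 \<nu>2 p q :: complex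
    and h :: "real \<Rightarrow> real \<Rightarrow> complex"
  assumes "Re \<gamma>1 > 0" "Re \<gamma>2 > 0" "Re \<kappa> > 0" "Re \<rho> > 0" "Re \<Upsilon> > 0"
    and "h = (\<lambda>X Y. of_real X powr (\<kappa> - 1) * of_real Y powr (\<rho> - 1) *
           HK_mittag_leffler \<gamma>1 \<gamma>2 ((\<gamma>1 + 1) / 2) \<gamma>2 \<kappa> \<rho> \<Upsilon> (\<nu>1 * of_real X) (\<nu>2 * of_real Y))"
    and "Re p > 0" "Re q > 0"
    and "norm (\<nu>2 powr \<Upsilon> / q powr \<Upsilon>) < 1"
    and "norm (\<nu>1 powr \<Upsilon> * q powr \<Upsilon> / (p * (q powr \<Upsilon> - \<nu>2 powr \<Upsilon>))) < 1"
  shows "(\<exists>P Q :: real. \<forall>p' q'. Re p' > P \<and> Re q' > Q \<longrightarrow> double_laplace_exists h p' q') \<and>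
    (double_laplace_exists h p q \<longrightarrow>
     double_laplace h p q =
       1 / (q powr \<rho> * p powr \<kappa>) *
       ((q powr \<Upsilon> - \<nu>2 powr \<Upsilon>) / q powr \<Upsilon>) powr (- \<gamma>2) *
       (1 - 4 * \<nu>1 * q powr \<Upsilon> / (p * (q powr \<Upsilon> - \<nu>2 powr \<Upsilon>))) powr (- (\<gamma>1 / 2)))"
proof (intro conjI impI)
  have h: "h = hk_weighted \<gamma>1 \<gamma>2 \<kappa> \<rho> \<Upsilon> \<nu>1 \<nu>2"
    by (simp add: assms(6) hk_weighted_def fun_eq_iff)
  show "\<exists>P Q :: real. \<forall>p' q'. Re p' > P \<and> Re q' > Q \<longrightarrow> double_laplace_exists h p' q'"
    using hk_double_series[OF assms(1-5), of \<nu>1 \<nu>2] unfolding h by metis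
  assume ex: "double_laplace_exists h p q"
  have "q powr \<Upsilon> \<noteq> 0" using assms(8) by auto
  then have v: "1 - \<nu>2 powr \<Upsilon> / q powr \<Upsilon> = (q powr \<Upsilon> - \<nu>2 powr \<Upsilon>) / q powr \<Upsilon>"
    by (simp add: diff_divide_distrib)
  have "double_laplace h p q = hk_closed \<gamma>1 \<gamma>2 \<kappa> \<rho> \<Upsilon> \<nu>1 (\<nu>2 powr \<Upsilon>) p q"
    using quadrant_laplace_eq_hk_closed[OF assms(1-5,7-9) ex[unfolded h]] double_laplace_eq_quadrant_laplace[OF ex]
    by (simp add: h)
  then show "double_laplace h p q = 1 / (q powr \<rho> * p powr \<kappa>) *
       ((q powr \<Upsilon> - \<nu>2 powr \<Upsilon>) / q powr \<Upsilon>) powr (- \<gamma>2) *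
       (1 - 4 * \<nu>1 * q powr \<Upsilon> / (p * (q powr \<Upsilon> - \<nu>2 powr \<Upsilon>))) powr (- (\<gamma>1 / 2))"
    by (simp add: hk_closed_def v)
qed

end
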